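(* For any rigid orthogonal spherical circle pattern that is a solution of a Dirichlet or Neumann boundary value problem, and for all sufficiently small $\epsilon$, there exists a spherical orthogonal ring pattern solving the same boundary value problem, parametrized by $q=1-\epsilon$, with the circle pattern corresponding to $q=1$. (That is, there are functions $\beta_i(\epsilon)$ with $\beta_i(0)=\beta_i^0$, the variables of the circle pattern, which solve the governing equations $f_i(\beta(\epsilon),1-\epsilon)=0$ of the boundary value problem for all sufficiently small $\epsilon$.)
   Context: Combinatorics: $\Pi\subset\mathbb{Z}^2$ is a simply connected (finite) cell complex defined by a set of elementary squares of the $\mathbb{Z}^2$ lattice, identified with its vertex set; $G=\{(m,n)\in\Pi: m+n\text{ even}\}$. Vertices $(m,n)$ and $(m\pm1,n\pm1)$ of $G$ are called neighboring. A vertex of $G$ is inner if it has four neighbors in $G$, otherwise a boundary vertex; $V(j)$ is the number of neighbors of $j$. Spherical orthogonal ring patterns assign to the vertices of $G$ rings on $S^2$ (pairs of concentric circles with inner signed radius $r$ and outer radius $R$), such that for neighboring rings the outer circle of each intersects the inner circle of the other orthogonally; for each ($m+n$ even) the inner circles at $(m,n),(m+2,n)$ and the outer circles at $(m+1,n\pm1)$ pass through one point; and the four touching points on each ring are in counter-clockwise (clockwise) order if $r>0$ ($r<0$). All rings satisfy $q\cos r=\cos R$ with common $q\le1$ and are encoded by $\beta$ via $\cos r=\operatorname{sn}(\beta,q)$, $\sin r=\operatorname{cn}(\beta,q)$, $\sin R=\operatorname{dn}(\beta,q)$ (Jacobi elliptic functions of modulus $q$). For $q=1$ one has $r=R$,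 i.e. orthogonal circle patterns with positively oriented circles, and $e^{\beta}=\cot\frac R2$. Functional: $g(x)=g(x;q)$ is the smooth real function $g(x)=\frac{\pi}{2}-\arg\operatorname{sn}\big(\frac{x+iK'}{2},q\big)=\arctan\frac{(1+q)\operatorname{sn}\frac x2}{\operatorname{cn}\frac x2\operatorname{dn}\frac x2}$ (continuous branch, $g(0)=0$; $g(x)=\arctan\sinh x$ for $q=1$), $F(x)=\int_0^xg(u)\,du$, and $$S_{sph}(\beta,q)=\sum_{(jk)}\big(F(\beta_j-\beta_k)-F(\beta_j+\beta_k)\big)+\sum_j\Phi_j\beta_j$$ (first sum over pairs of neighboring vertices, second over all vertices of $G$), with $\Phi_j=2\pi$ for inner rings, $\Phi_j=\pi V(j)-\Theta(j)$ for positively oriented boundary rings and $\Phi_j=-\Theta(j)$ for negatively oriented boundary rings, $\Theta(j)$ being the prescribed cone angle at the boundary ring $j$ (the total opening angle covered by its neighbors). Boundary value problems: in the Dirichlet problem the variables $\beta_j$ of boundary rings are prescribed and the unknowns are the $\beta_i$ of the inner rings; in the Neumann problem the boundary cone angles $\Theta(j)$ are prescribed and the unknowns are the $\beta_i$ of all rings. In both cases, with $N$ unknowns $\beta_i$, the governing equations are $f_i(\beta,q):=\frac{\partial S_{sph}}{\partial\beta_i}=0$, $i=1,\dots,N$. A circle pattern solution has variables $\beta_i^0=\log\cot\frac{R_i^0}{2}$ with $f_i(\beta^0,1)=0$, where $R_i^0$ are the spherical radii. Rigidity: the circle pattern allows an infinitesimal deformation if there exists a non-zero $(\phi_1,\dots,\phi_N)$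 with $f_i(\beta^0+\epsilon\phi,1)=o(\epsilon)$ for all $i$; it is rigid if it allows none. *)

theory Defs
  imports "HOL-Analysis.Analysis" "HOL-Library.Landau_Symbols"
begin

section \<open>Jacobi elliptic functions of modulus \<open>q\<close>, for real argument and \<open>0 \<le> q \<le> 1\<close>\<close>

text \<open>
  The amplitude inverts the incomplete elliptic integral of the first kind. The first conjunct
  is void for \<open>q < 1\<close>; for \<open>q = 1\<close> it confines the amplitude to \<open>]-\<pi>/2, \<pi>/2[\<close>, beyond
  which the integral diverges (and \<open>LBINT\<close> would silently return 0).
\<close>

definition elliptic_integral_F :: "real \<Rightarrow> real \<Rightarrow> real" where
  "elliptic_integral_F \<phi> q =
     (LBINT \<theta>=ereal 0..ereal \<phi>. 1 / sqrt (1 - q\<^sup>2 * (sin \<theta>)\<^sup>2))"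

definition jacobi_am :: "real \<Rightarrow> real \<Rightarrow> real" where
  "jacobi_am u q =
     (THE \<phi>. (\<forall>\<theta>\<in>closed_segment 0 \<phi>. q\<^sup>2 * (sin \<theta>)\<^sup>2 < 1) \<and> elliptic_integral_F \<phi> q = u)"

definition jacobi_sn :: "real \<Rightarrow> real \<Rightarrow> real" where
  "jacobi_sn u q = sin (jacobi_am u q)"

definition jacobi_cn :: "real \<Rightarrow> real \<Rightarrow> real" where
  "jacobi_cn u q = cos (jacobi_am u q)"

definition jacobi_dn :: "real \<Rightarrow> real \<Rightarrow> real" where
  "jacobi_dn u q = sqrt (1 - q\<^sup>2 * (jacobi_sn u q)\<^sup>2)"

section \<open>Combinatorics\<close>

type_synonym vertex = "int \<times> int"

text \<open>A square is named by its lower left corner.\<close>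

definition square_corners :: "vertex \<Rightarrow> vertex set" where
  "square_corners s = {fst s, fst s + 1} \<times> {snd s, snd s + 1}"

definition square_region :: "vertex \<Rightarrow> (real \<times> real) set" where
  "square_region s =
     {of_int (fst s)..of_int (fst s) + 1} \<times> {of_int (snd s)..of_int (snd s) + 1}"

definition simply_connected_complex :: "vertex set \<Rightarrow> bool" where
  "simply_connected_complex Q \<longleftrightarrow> finite Q \<and> simply_connected (\<Union>s\<in>Q. square_region s)"

definition ring_vertices :: "vertex set \<Rightarrow> vertex set" where
  "ring_vertices Q = {v \<in> (\<Union>s\<in>Q. square_corners s). even (fst v + snd v)}"

definition neighboring :: "vertex \<Rightarrow> vertex \<Rightarrow> bool" where
  "neighboring j k \<longleftrightarrow> \<bar>fst k - fst j\<bar> = 1 \<and> \<bar>snd k - snd j\<bar> = 1"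

definition valency :: "vertex set \<Rightarrow> vertex \<Rightarrow> nat" where
  "valency G j = card {k \<in> G. neighboring j k}"

definition inner_vertices :: "vertex set \<Rightarrow> vertex set" where
  "inner_vertices G = {j \<in> G. valency G j = 4}"

definition boundary_vertices :: "vertex set \<Rightarrow> vertex set" where
  "boundary_vertices G = G - inner_vertices G"

text \<open>
  Every unordered pair of neighbors is listed once, from left to right. The order is immaterial
  for the functional below, since \<open>F_int\<close> is even.
\<close>

definition edges :: "vertex set \<Rightarrow> (vertex \<times> vertex) set" where
  "edges G = {(j, k) \<in> G \<times> G. neighboring j k \<and> fst k = fst j + 1}"

section \<open>The functional\<close>

text \<open>
  The continuous branch of \<open>arctan ((1 + q) sn(x/2) / (cn(x/2) dn(x/2)))\<close> vanishing at 0.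
  The equation for the tangent is cleared of denominators, so it also covers the zeros
  of \<open>cn\<close>, where the branch passes through an odd multiple of \<open>\<pi>/2\<close>.
\<close>

definition g_fun :: "real \<Rightarrow> real \<Rightarrow> real" where
  "g_fun q = (THE h. continuous_on UNIV h \<and> h 0 = 0 \<and>
     (\<forall>x. sin (h x) * (jacobi_cn (x / 2) q * jacobi_dn (x / 2) q) =
          cos (h x) * ((1 + q) * jacobi_sn (x / 2) q)))"

definition F_int :: "real \<Rightarrow> real \<Rightarrow> real" where
  "F_int q x = (LBINT u=ereal 0..ereal x. g_fun q u)"

text \<open>
  Since \<open>sin r = cn(\<beta>, q)\<close>, this is the condition \<open>r > 0\<close> on the signed inner radius.
\<close>

definition positively_oriented :: "real \<Rightarrow> real \<Rightarrow> bool" where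
  "positively_oriented q b \<longleftrightarrow> jacobi_cn b q > 0"

text \<open>\<open>\<Theta>\<close> are the cone angles, \<open>\<sigma>\<close> singles out the positively oriented rings.\<close>

definition Phi :: "vertex set \<Rightarrow> (vertex \<Rightarrow> real) \<Rightarrow> (vertex \<Rightarrow> bool) \<Rightarrow> vertex \<Rightarrow> real" where
  "Phi G \<Theta> \<sigma> j =
     (if j \<in> inner_vertices G then 2 * pi
      else if \<sigma> j then pi * real (valency G j) - \<Theta> j
      else - \<Theta> j)"

definition S_sph ::
  "vertex set \<Rightarrow> (vertex \<Rightarrow> real) \<Rightarrow> (vertex \<Rightarrow> bool) \<Rightarrow> (vertex \<Rightarrow> real) \<Rightarrow> real \<Rightarrow> real" where
  "S_sph G \<Theta> \<sigma> \<beta> q =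
     (\<Sum>(j, k)\<in>edges G. F_int q (\<beta> j - \<beta> k) - F_int q (\<beta> j + \<beta> k)) +
     (\<Sum>j\<in>G. Phi G \<Theta> \<sigma> j * \<beta> j)"

text \<open>
  The partial derivative of the functional with respect to \<open>\<beta>\<^sub>i\<close>. The coefficients \<open>\<Phi>\<close> are
  constants in the differentiation: they are those of the orientations of the rings \<open>\<beta>\<close>.
\<close>

definition f_eq ::
  "vertex set \<Rightarrow> (vertex \<Rightarrow> real) \<Rightarrow> vertex \<Rightarrow> (vertex \<Rightarrow> real) \<Rightarrow> real \<Rightarrow> real" where
  "f_eq G \<Theta> i \<beta> q =
     deriv (\<lambda>t. S_sph G \<Theta> (\<lambda>j. positively_oriented q (\<beta> j)) (\<beta>(i := t)) q) (\<beta> i)"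

section \<open>Boundary value problems\<close>

text \<open>
  The data are the boundary values of \<open>\<beta>\<close>, respectively the boundary cone angles; only the
  values of these functions at boundary vertices matter.
\<close>

datatype bvp = Dirichlet "vertex \<Rightarrow> real" | Neumann "vertex \<Rightarrow> real"

primrec unknowns :: "vertex set \<Rightarrow> bvp \<Rightarrow> vertex set" where
  "unknowns G (Dirichlet b) = inner_vertices G"
| "unknowns G (Neumann \<Theta>) = G"

primrec boundary_data :: "vertex set \<Rightarrow> bvp \<Rightarrow> (vertex \<Rightarrow> real) \<Rightarrow> bool" where
  "boundary_data G (Dirichlet b) \<beta> \<longleftrightarrow> (\<forall>j\<in>boundary_vertices G. \<beta> j = b j)"
| "boundary_data G (Neumann \<Theta>) \<beta> \<longleftrightarrow> True"

text \<open>
  In a Dirichlet problem the cone angles occur only in terms of the functional that do not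
  involve the unknowns, so any value may be inserted for them.
\<close>

primrec cone_angles :: "bvp \<Rightarrow> vertex \<Rightarrow> real" where
  "cone_angles (Dirichlet b) = (\<lambda>_. 0)"
| "cone_angles (Neumann \<Theta>) = \<Theta>"

definition solves_bvp :: "vertex set \<Rightarrow> bvp \<Rightarrow> (vertex \<Rightarrow> real) \<Rightarrow> real \<Rightarrow> bool" where
  "solves_bvp G P \<beta> q \<longleftrightarrow>
     boundary_data G P \<beta> \<and> (\<forall>i\<in>unknowns G P. f_eq G (cone_angles P) i \<beta> q = 0)"

text \<open>A deformation moves the unknowns only: \<open>\<phi>\<close> vanishes at all other vertices.\<close>

definition infinitesimal_deformation ::
  "vertex set \<Rightarrow> bvp \<Rightarrow> (vertex \<Rightarrow> real) \<Rightarrow> (vertex \<Rightarrow> real) \<Rightarrow> bool" where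
  "infinitesimal_deformation G P \<beta>0 \<phi> \<longleftrightarrow>
     (\<forall>j. j \<notin> unknowns G P \<longrightarrow> \<phi> j = 0) \<and>
     (\<exists>i\<in>unknowns G P. \<phi> i \<noteq> 0) \<and>
     (\<forall>i\<in>unknowns G P.
        (\<lambda>\<epsilon>. f_eq G (cone_angles P) i (\<lambda>j. \<beta>0 j + \<epsilon> * \<phi> j) 1) \<in> o[at 0](\<lambda>\<epsilon>. \<epsilon>))"

definition rigid :: "vertex set \<Rightarrow> bvp \<Rightarrow> (vertex \<Rightarrow> real) \<Rightarrow> bool" where
  "rigid G P \<beta>0 \<longleftrightarrow> (\<nexists>\<phi>. infinitesimal_deformation G P \<beta>0 \<phi>)"

end

theory Submission
  imports Defs
begin

text \<open>
  As long as the orientations of the rings do not change, the governing equations depend on the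
  modulus only through the function \<open>g\<close>. Once \<open>g(x; q)\<close> and \<open>g'(x; q)\<close> are known to depend continuously on \<open>q\<close> up to and including the degenerate
  modulus \<open>q = 1\<close>, the theorem is an implicit function theorem at the circle pattern: the
  equations are differentiable at \<open>q = 1\<close>, so rigidity says exactly that their Jacobian matrix has
  trivial kernel, hence is invertible, and the zero \<open>\<beta>\<^sup>0\<close> persists for \<open>q\<close> near 1.

  \<^emph>\<open>The elliptic functions at \<open>q = 1\<close>.\<close> The period lattice degenerates at \<open>q = 1\<close> and the elliptic
  integral \<open>F(\<phi>, q)\<close> diverges at \<open>\<phi> = \<pi>/2\<close>, so nothing uniform in \<open>\<phi>\<close> can be expected. The
  amplitude is nevertheless jointly continuous: \<open>am(u, q) > \<phi>\<close> means \<open>F(\<phi>, q) < u\<close>, an open condition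
  on \<open>(u, q)\<close> for each fixed \<open>\<phi>\<close> (\<open>continuous_on_jacobi_am\<close>).

  \<^emph>\<open>The function \<open>g\<close>.\<close> With \<open>s, c, d\<close> the Jacobi functions of \<open>x/2\<close>, the vector
  \<open>(c d, (1 + q) s) / (1 + q s\<^sup>2)\<close> has length 1 and rotates with the angular velocity
  \<open>(1 + q)/2 \<cdot> (1 - q s\<^sup>2)/(1 + q s\<^sup>2)\<close>; \<open>g\<close> is its continuous angle, that is, the integral of this
  velocity. (This is Landen's transformation: \<open>g(x; q)\<close> is an amplitude at
  the modulus \<open>2 \<surd>q / (1 + q)\<close>.) So \<open>g\<close> is differentiable in \<open>x\<close>, with a derivative
  jointly continuous in \<open>x\<close> and \<open>q\<close>
  (\<open>g_fun_has_derivative\<close>, \<open>continuous_on_phase_rate\<close>).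

  \<^emph>\<open>The implicit function theorem.\<close> The parameter \<open>q\<close> ends at 1, and there the equations are
  controlled in \<open>q\<close> by continuity only. The appropriate version asks for strict differentiability in
  the unknowns, uniformly in the parameter, and for mere continuity in the parameter
  (\<open>zeros_near_nondegenerate_zero\<close>). It is proved by contraction with the inverse of the matrix at the
  base point. The required uniform strict differentiability comes from the mean value theorem, applied
  to \<open>g\<close> edge by edge (\<open>angle_defect_uniformly_strictly_differentiable\<close>).

  \<^emph>\<open>Orientation.\<close> The constant \<open>\<Phi>\<^sub>j\<close> of a boundary ring jumps with its orientation. At \<open>q = 1\<close> all
  rings are positively oriented, as \<open>cn = 1 / cosh\<close>, and this persists near \<open>\<beta>\<^sup>0\<close> for \<open>q\<close> near 1; there
  the equations agree with those for the constants of positive orientation (\<open>angle_defect\<close>).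
\<close>

section \<open>Integrals from 0 to a variable end point\<close>

lemma LBINT_has_real_derivative:
  fixes f :: "real \<Rightarrow> real"
  assumes "open S" "is_interval S" "0 \<in> S" "x \<in> S" "continuous_on S f"
  shows "((\<lambda>u. LBINT t=ereal 0..ereal u. f t) has_real_derivative f x) (at x)"
proof -
  obtain d where d: "d > 0" "cball x d \<subseteq> S"
    using assms(1,4) open_contains_cball by blast
  define a where "a = min 0 (x - d)"
  define b where "b = max 0 (x + d)"
  have "x - d \<in> S" "x + d \<in> S"
    using d by (auto simp: subset_iff dist_real_def)
  then have ab: "a \<in> S" "b \<in> S"
    using assms(3) by (simp_all add: a_def b_def min_def max_def)
  have "{a..b} \<subseteq> S"
    using mem_is_interval_1_I[OF assms(2) ab] by force
  then have "((\<lambda>u. LBINT t=ereal 0..ereal u. f t) has_vector_derivative f x) (at x within {a..b})"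
    using assms(5) d(1)
    by (intro interval_integral_FTC2) (auto simp: a_def b_def intro: continuous_on_subset)
  moreover have "at x within {a..b} = at x"
    using d(1) by (intro at_within_interior) (auto simp: a_def b_def)
  ultimately show ?thesis
    by (simp add: has_real_derivative_iff_has_vector_derivative)
qed

lemma continuous_on_LBINT_param:
  fixes f :: "real \<Rightarrow> 'a::topological_space \<Rightarrow> real"
  assumes "continuous_on (closed_segment 0 x \<times> U) (\<lambda>(t, q). f t q)"
  shows "continuous_on U (\<lambda>q. LBINT t=ereal 0..ereal x. f t q)"
proof -
  define a where "a = min 0 x"
  define b where "b = max 0 x"
  have seg: "closed_segment 0 x = {a..b}"
    by (auto simp: a_def b_def closed_segment_eq_real_ivl)
  have "continuous_on (U \<times> cbox a b) ((\<lambda>(t, q). f t q) \<circ> prod.swap)"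
    using assms by (intro continuous_on_compose continuous_on_swap) (simp add: seg product_swap)
  then have param: "continuous_on U (\<lambda>q. integral (cbox a b) (\<lambda>t. f t q))"
    by (intro integral_continuous_on_param) (simp add: o_def case_prod_beta)
  have "(LBINT t=ereal 0..ereal x. f t q) = sgn x * integral (cbox a b) (\<lambda>t. f t q)" if "q \<in> U" for q
  proof -
    have "continuous_on {a..b} ((\<lambda>(t, q). f t q) \<circ> (\<lambda>t. (t, q)))"
      using that
      by (intro continuous_on_compose continuous_on_subset[OF assms] continuous_intros) (auto simp: seg)
    then have "set_integrable lborel {a..b} (\<lambda>t. f t q)"
      by (intro borel_integrable_atLeastAtMost') (simp add: o_def)
    then have "(LBINT t=ereal a..ereal b. f t q) = integral (cbox a b) (\<lambda>t. f t q)"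
      by (subst interval_integral_eq_integral) (auto simp: a_def b_def)
    moreover have "(LBINT t=ereal 0..ereal x. f t q) = sgn x * (LBINT t=ereal a..ereal b. f t q)"
      using interval_integral_endpoints_reverse[of "ereal 0" "ereal x" "\<lambda>t. f t q"]
      by (cases x "0::real" rule: linorder_cases) (simp_all add: a_def b_def)
    ultimately show ?thesis
      by simp
  qed
  moreover have "continuous_on U (\<lambda>q. sgn x * integral (cbox a b) (\<lambda>t. f t q))"
    by (intro continuous_intros param)
  ultimately show ?thesis
    by (simp cong: continuous_on_cong)
qed

section \<open>The Jacobi amplitude as a function of argument and modulus\<close>

text \<open>
  The values that the amplitude may take: the component of \<open>{\<phi>. q\<^sup>2 sin\<^sup>2 \<phi> < 1}\<close> around 0, over which
  the elliptic integral is regular.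
\<close>

definition amplitude_range :: "real \<Rightarrow> real set" where
  "amplitude_range q = (if q = 1 then {- pi / 2<..<pi / 2} else UNIV)"

lemma
  shows zero_in_amplitude_range: "0 \<in> amplitude_range q"
    and open_amplitude_range: "open (amplitude_range q)"
    and is_interval_amplitude_range: "is_interval (amplitude_range q)"
  by (simp_all add: amplitude_range_def is_interval_oo)

lemma elliptic_radicand_pos:
  assumes "0 \<le> q" "q \<le> 1" "\<phi> \<in> amplitude_range q"
  shows "q\<^sup>2 * (sin \<phi>)\<^sup>2 < 1"
proof (cases "q = 1")
  case True
  then have "cos \<phi> > 0"
    using assms by (intro cos_gt_zero_pi) (auto simp: amplitude_range_def)
  then have "(sin \<phi>)\<^sup>2 < 1"
    using sin_cos_squared_add[of \<phi>] zero_less_power[of "cos \<phi>" 2] by linarith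
  then show ?thesis
    using True by simp
next
  case False
  then have "q\<^sup>2 < 1"
    using assms by (simp add: power2_eq_1_iff power_less_one_iff abs_square_less_1)
  moreover have "q\<^sup>2 * (sin \<phi>)\<^sup>2 \<le> q\<^sup>2 * 1"
    using sin_cos_squared_add[of \<phi>] by (intro mult_left_mono) (auto simp: abs_square_le_1)
  ultimately show ?thesis
    by simp
qed

lemma amplitude_range_iff:
  assumes "0 \<le> q" "q \<le> 1"
  shows "(\<forall>\<theta>\<in>closed_segment 0 \<phi>. q\<^sup>2 * (sin \<theta>)\<^sup>2 < 1) \<longleftrightarrow> \<phi> \<in> amplitude_range q"
proof
  assume *: "\<forall>\<theta>\<in>closed_segment 0 \<phi>. q\<^sup>2 * (sin \<theta>)\<^sup>2 < 1"
  show "\<phi> \<in> amplitude_range q"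
  proof (rule ccontr)
    assume "\<phi> \<notin> amplitude_range q"
    then have q: "q = 1" and "\<phi> \<ge> pi / 2 \<or> \<phi> \<le> - (pi / 2)"
      by (auto simp: amplitude_range_def split: if_splits)
    then have "pi / 2 \<in> closed_segment 0 \<phi> \<or> - (pi / 2) \<in> closed_segment 0 \<phi>"
      by (auto simp: closed_segment_eq_real_ivl)
    then show False
      using * q by fastforce
  qed
next
  assume "\<phi> \<in> amplitude_range q"
  moreover have "closed_segment 0 \<phi> \<subseteq> amplitude_range q"
    using is_interval_amplitude_range zero_in_amplitude_range calculation
    by (metis closed_segment_subset is_interval_convex)
  ultimately show "\<forall>\<theta>\<in>closed_segment 0 \<phi>. q\<^sup>2 * (sin \<theta>)\<^sup>2 < 1"
    using elliptic_radicand_pos[OF assms] by blast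
qed

lemma continuous_on_elliptic_integrand:
  "continuous_on {(\<theta>, q). 0 \<le> q \<and> q \<le> 1 \<and> \<theta> \<in> amplitude_range q}
     (\<lambda>(\<theta>, q). 1 / sqrt (1 - q\<^sup>2 * (sin \<theta>)\<^sup>2))"
  unfolding case_prod_beta
  using elliptic_radicand_pos
  by (intro continuous_intros) (fastforce simp: less_le)

lemma elliptic_integral_F_has_derivative:
  assumes "0 \<le> q" "q \<le> 1" "\<phi> \<in> amplitude_range q"
  shows "((\<lambda>\<phi>. elliptic_integral_F \<phi> q) has_real_derivative
           1 / sqrt (1 - q\<^sup>2 * (sin \<phi>)\<^sup>2)) (at \<phi>)"
proof -
  have "continuous_on (amplitude_range q)
          ((\<lambda>(\<theta>, q). 1 / sqrt (1 - q\<^sup>2 * (sin \<theta>)\<^sup>2)) \<circ> (\<lambda>\<theta>. (\<theta>, q)))"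
    using assms
    by (intro continuous_on_compose continuous_on_subset[OF continuous_on_elliptic_integrand]
        continuous_intros) auto
  then show ?thesis
    unfolding elliptic_integral_F_def
    using LBINT_has_real_derivative[OF open_amplitude_range is_interval_amplitude_range
        zero_in_amplitude_range assms(3), of "\<lambda>\<theta>. 1 / sqrt (1 - q\<^sup>2 * (sin \<theta>)\<^sup>2)"]
    by (simp add: o_def)
qed

lemma elliptic_integral_F_0: "elliptic_integral_F 0 q = 0"
  by (simp add: elliptic_integral_F_def)

lemma elliptic_integral_F_strict_mono:
  assumes q: "0 \<le> q" "q \<le> 1"
    and "\<phi> \<in> amplitude_range q" "\<psi> \<in> amplitude_range q" "\<phi> < \<psi>"
  shows "elliptic_integral_F \<phi> q < elliptic_integral_F \<psi> q"
proof (rule DERIV_pos_imp_increasing[OF \<open>\<phi> < \<psi>\<close>])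
  fix x assume "\<phi> \<le> x" "x \<le> \<psi>"
  then have "x \<in> amplitude_range q"
    using mem_is_interval_1_I[OF is_interval_amplitude_range] assms by blast
  then show "\<exists>y. ((\<lambda>\<phi>. elliptic_integral_F \<phi> q) has_real_derivative y) (at x) \<and> 0 < y"
    using elliptic_integral_F_has_derivative[OF q] elliptic_radicand_pos[OF q] by fastforce
qed

text \<open>
  At \<open>q = 1\<close> the amplitude is the Gudermannian function. This shows that the integral takes all real
  values on the bounded interval that is left for \<open>\<phi>\<close>.
\<close>

lemma elliptic_integral_F_arctan_sinh: "elliptic_integral_F (arctan (sinh u)) 1 = u"
proof -
  have "((\<lambda>u. elliptic_integral_F (arctan (sinh u)) 1 - u) has_real_derivative 0) (at v)" for v :: real
  proof -
    have "1 - (sin (arctan (sinh v)))\<^sup>2 = (cos (arctan (sinh v)))\<^sup>2"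
      using sin_cos_squared_add[of "arctan (sinh v)"] by linarith
    moreover have cosh: "1 + (sinh v)\<^sup>2 = (cosh v)\<^sup>2"
      by (simp add: cosh_square_eq)
    ultimately have sqrt: "sqrt (1 - 1\<^sup>2 * (sin (arctan (sinh v)))\<^sup>2) = 1 / cosh v"
      by (simp add: cos_arctan cosh)
    have deriv: "((\<lambda>u. arctan (sinh u)) has_real_derivative 1 / cosh v) (at v)"
      by (auto intro!: derivative_eq_intros simp: cosh field_simps power2_eq_square[of "cosh v"])
    have "((\<lambda>\<phi>. elliptic_integral_F \<phi> 1) has_real_derivative cosh v) (at (arctan (sinh v)))"
      using elliptic_integral_F_has_derivative[of 1 "arctan (sinh v)"] sqrt
      using arctan_lbound[of "sinh v"] arctan_ubound[of "sinh v"] by (simp add: amplitude_range_def)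
    from DERIV_chain2[OF this deriv]
    have "((\<lambda>u. elliptic_integral_F (arctan (sinh u)) 1) has_real_derivative 1) (at v)"
      by simp
    from DERIV_diff[OF this DERIV_ident] show ?thesis
      by simp
  qed
  then have "elliptic_integral_F (arctan (sinh u)) 1 - u = elliptic_integral_F (arctan (sinh 0)) 1 - 0"
    by (intro DERIV_isconst_all) blast
  then show ?thesis
    by (simp add: elliptic_integral_F_0)
qed

lemma elliptic_integral_F_surj:
  assumes q: "0 \<le> q" "q \<le> 1"
  shows "\<exists>\<phi>\<in>amplitude_range q. elliptic_integral_F \<phi> q = u"
proof (cases "q = 1")
  case True
  then show ?thesis
    using elliptic_integral_F_arctan_sinh[of u] arctan_lbound[of "sinh u"] arctan_ubound[of "sinh u"]
    by (intro bexI[of _ "arctan (sinh u)"]) (simp_all add: amplitude_range_def)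
next
  case False
  let ?F = "\<lambda>\<phi>. elliptic_integral_F \<phi> q"
  have range: "amplitude_range q = UNIV"
    using False by (simp add: amplitude_range_def)
  have deriv: "((\<lambda>\<phi>. ?F \<phi> - \<phi>) has_real_derivative 1 / sqrt (1 - q\<^sup>2 * (sin x)\<^sup>2) - 1) (at x)" for x
    using elliptic_integral_F_has_derivative[OF q] range by (auto intro!: derivative_intros)
  have nonneg: "1 / sqrt (1 - q\<^sup>2 * (sin x)\<^sup>2) - 1 \<ge> 0" for x
    using elliptic_radicand_pos[OF q, of x] range by (simp add: real_le_lsqrt)
  have mono: "?F a - a \<le> ?F b - b" if "a \<le> b" for a b
    using deriv nonneg by (intro DERIV_nonneg_imp_nondecreasing[OF that]) blast
  have "\<exists>\<phi>. - \<bar>u\<bar> \<le> \<phi> \<and> \<phi> \<le> \<bar>u\<bar> \<and> ?F \<phi> = u"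
  proof (rule IVT)
    show "?F (- \<bar>u\<bar>) \<le> u" "u \<le> ?F \<bar>u\<bar>"
      using mono[of "- \<bar>u\<bar>" 0] mono[of 0 "\<bar>u\<bar>"] by (simp_all add: elliptic_integral_F_0)
    show "\<forall>x. - \<bar>u\<bar> \<le> x \<and> x \<le> \<bar>u\<bar> \<longrightarrow> isCont ?F x"
      using elliptic_integral_F_has_derivative[OF q] range DERIV_isCont by blast
  qed simp
  then show ?thesis
    using range by auto
qed

lemma jacobi_am_props:
  assumes q: "0 \<le> q" "q \<le> 1"
  shows jacobi_am_in_range: "jacobi_am u q \<in> amplitude_range q"
    and elliptic_integral_F_jacobi_am: "elliptic_integral_F (jacobi_am u q) q = u"
proof -
  have "\<exists>!\<phi>. \<phi> \<in> amplitude_range q \<and> elliptic_integral_F \<phi> q = u"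
    using elliptic_integral_F_surj[OF q, of u] elliptic_integral_F_strict_mono[OF q]
    by (metis less_irrefl linorder_neqE_linordered_idom)
  then have "jacobi_am u q \<in> amplitude_range q \<and> elliptic_integral_F (jacobi_am u q) q = u"
    unfolding jacobi_am_def amplitude_range_iff[OF q] by (rule theI')
  then show "jacobi_am u q \<in> amplitude_range q" "elliptic_integral_F (jacobi_am u q) q = u"
    by auto
qed

text \<open>
  Comparisons of the amplitude with a fixed \<open>\<phi>\<close> become comparisons of \<open>u\<close> with an integral over a fixed
  interval, which is continuous in the modulus.
\<close>

lemma jacobi_am_less_iff:
  assumes "0 \<le> q" "q \<le> 1" "\<phi> \<in> amplitude_range q"
  shows "\<phi> < jacobi_am u q \<longleftrightarrow> elliptic_integral_F \<phi> q < u"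
    and "jacobi_am u q < \<phi> \<longleftrightarrow> u < elliptic_integral_F \<phi> q"
  using assms elliptic_integral_F_strict_mono[of q] jacobi_am_props[of q u]
  by (metis less_irrefl less_trans linorder_neqE_linordered_idom)+

lemma jacobi_am_0:
  assumes "0 \<le> q" "q \<le> 1"
  shows "jacobi_am 0 q = 0"
  using jacobi_am_less_iff[OF assms zero_in_amplitude_range, of 0] elliptic_integral_F_0[of q] by force

text \<open>
  An admissible \<open>\<phi>\<close> for the modulus \<open>q\<close> stays admissible for the moduli near \<open>q\<close>: if \<open>q < 1\<close> then these
  are less than 1 as well, and if \<open>q = 1\<close> then \<open>\<phi>\<close> lies in the smallest of all ranges.
\<close>

lemma elliptic_integral_F_tendsto:
  assumes "0 \<le> q" "q \<le> 1" "\<phi> \<in> amplitude_range q"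
  shows "((\<lambda>p. elliptic_integral_F \<phi> (snd p)) \<longlongrightarrow> elliptic_integral_F \<phi> q)
           (at (u, q) within UNIV \<times> {0..1})"
    and "\<forall>\<^sub>F p in at (u, q) within UNIV \<times> {0..1}. \<phi> \<in> amplitude_range (snd p)"
proof -
  define U where "U = {p \<in> {0..1}. \<phi> \<in> amplitude_range p}"
  have seg: "closed_segment 0 \<phi> \<subseteq> amplitude_range p" if "\<phi> \<in> amplitude_range p" for p
    using is_interval_amplitude_range zero_in_amplitude_range that
    by (metis closed_segment_subset is_interval_convex)
  have "continuous_on U (\<lambda>p. elliptic_integral_F \<phi> p)"
    unfolding elliptic_integral_F_def using seg
    by (intro continuous_on_LBINT_param continuous_on_subset[OF continuous_on_elliptic_integrand])
       (auto simp: U_def)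
  moreover have "q \<in> U"
    using assms by (simp add: U_def)
  ultimately have "((\<lambda>p. elliptic_integral_F \<phi> p) \<longlongrightarrow> elliptic_integral_F \<phi> q) (at q within U)"
    by (simp add: continuous_on_def)
  \<comment> \<open>A witness that the admissible moduli form a relatively open subset of \<open>[0, 1]\<close>.\<close>
  define V where "V = (if \<phi> \<in> amplitude_range 1 then UNIV else {..<1::real})"
  have V: "open V" "U = V \<inter> {0..1}"
    by (auto simp: V_def U_def amplitude_range_def)
  have "continuous_on (UNIV \<times> U) (\<lambda>p. elliptic_integral_F \<phi> (snd p))"
    by (rule continuous_on_compose2[OF \<open>continuous_on U (\<lambda>p. elliptic_integral_F \<phi> p)\<close>])
       (auto intro: continuous_intros)
  then have "((\<lambda>p. elliptic_integral_F \<phi> (snd p)) \<longlongrightarrow> elliptic_integral_F \<phi> q)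
      (at (u, q) within UNIV \<times> U)"
    using \<open>q \<in> U\<close> by (auto simp: continuous_on_def)
  moreover have "at (u, q) within UNIV \<times> U = at (u, q) within UNIV \<times> {0..1}"
    using V \<open>q \<in> U\<close> by (intro at_within_nhd[of _ "UNIV \<times> V"]) (auto intro: open_Times)
  ultimately show "((\<lambda>p. elliptic_integral_F \<phi> (snd p)) \<longlongrightarrow> elliptic_integral_F \<phi> q)
      (at (u, q) within UNIV \<times> {0..1})"
    by simp
  have "\<forall>\<^sub>F p in at (u, q) within UNIV \<times> U. p \<in> UNIV \<times> U"
    by (simp add: eventually_at_filter)
  then show "\<forall>\<^sub>F p in at (u, q) within UNIV \<times> {0..1}. \<phi> \<in> amplitude_range (snd p)"
    unfolding \<open>at (u, q) within UNIV \<times> U = _\<close> by eventually_elim (auto simp: U_def)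
qed

lemma amplitude_range_dense:
  assumes "a \<in> amplitude_range q"
  shows "l < a \<Longrightarrow> \<exists>\<phi>\<in>amplitude_range q. l < \<phi> \<and> \<phi> < a"
    and "a < r \<Longrightarrow> \<exists>\<phi>\<in>amplitude_range q. a < \<phi> \<and> \<phi> < r"
proof -
  obtain d where d: "d > 0" "cball a d \<subseteq> amplitude_range q"
    using open_amplitude_range assms open_contains_cball by blast
  then have ball: "\<phi> \<in> amplitude_range q" if "\<bar>a - \<phi>\<bar> \<le> d" for \<phi>
    using that by (auto simp: dist_real_def)
  show "\<exists>\<phi>\<in>amplitude_range q. l < \<phi> \<and> \<phi> < a" if "l < a"
  proof (rule bexI)
    show "l < a - min d ((a - l) / 2) \<and> a - min d ((a - l) / 2) < a"
      using d(1) that min.cobounded2[of d "(a - l) / 2"] by auto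
    show "a - min d ((a - l) / 2) \<in> amplitude_range q"
      using d(1) that by (intro ball) simp
  qed
  show "\<exists>\<phi>\<in>amplitude_range q. a < \<phi> \<and> \<phi> < r" if "a < r"
  proof (rule bexI)
    show "a < a + min d ((r - a) / 2) \<and> a + min d ((r - a) / 2) < r"
      using d(1) that min.cobounded2[of d "(r - a) / 2"] by auto
    show "a + min d ((r - a) / 2) \<in> amplitude_range q"
      using d(1) that by (intro ball) simp
  qed
qed

text \<open>
  Both order conditions that define a neighbourhood of \<open>am(u, q)\<close> are tested at some \<open>\<phi>\<close> strictly between,
  where they are strict inequalities between continuous functions of \<open>(u, q)\<close>. Each test takes place at one
  fixed \<open>\<phi>\<close> inside the range, away from the end points at which the integral diverges for \<open>q = 1\<close>.
\<close>

lemma continuous_on_jacobi_am: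
  "continuous_on (UNIV \<times> {0..1}) (\<lambda>(u, q). jacobi_am u q)"
  unfolding continuous_on_def
proof
  fix p0 :: "real \<times> real"
  assume p0: "p0 \<in> UNIV \<times> {0..1}"
  define u q where "u = fst p0" and "q = snd p0"
  have q: "0 \<le> q" "q \<le> 1"
    using p0 by (auto simp: q_def)
  let ?at = "at (u, q) within UNIV \<times> {0..1}"
  have fst: "((\<lambda>p. fst p) \<longlongrightarrow> u) ?at"
    by (rule tendsto_eq_intros refl)+ simp
  have in_range: "\<forall>\<^sub>F p in ?at. snd p \<in> {0..1}"
    by (auto simp: eventually_at_filter intro!: always_eventually)
  have "((\<lambda>p. jacobi_am (fst p) (snd p)) \<longlongrightarrow> jacobi_am u q) ?at"
  proof (rule order_tendstoI)
    fix l assume "l < jacobi_am u q"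
    then obtain \<phi> where \<phi>: "\<phi> \<in> amplitude_range q" "l < \<phi>" "\<phi> < jacobi_am u q"
      using amplitude_range_dense jacobi_am_props[OF q] by blast
    have "((\<lambda>p. fst p - elliptic_integral_F \<phi> (snd p)) \<longlongrightarrow> u - elliptic_integral_F \<phi> q) ?at"
      by (intro tendsto_diff fst elliptic_integral_F_tendsto q \<phi>)
    moreover have "u - elliptic_integral_F \<phi> q > 0"
      using jacobi_am_less_iff[OF q \<phi>(1)] \<phi>(3) by simp
    ultimately have "\<forall>\<^sub>F p in ?at. fst p - elliptic_integral_F \<phi> (snd p) > 0"
      by (rule order_tendstoD)
    with in_range elliptic_integral_F_tendsto(2)[OF q \<phi>(1), of u]
    show "\<forall>\<^sub>F p in ?at. l < jacobi_am (fst p) (snd p)"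
    proof eventually_elim
      case (elim p)
      then show ?case
        using jacobi_am_less_iff(1)[of "snd p" \<phi> "fst p"] \<phi>(2) by simp
    qed
  next
    fix r assume "jacobi_am u q < r"
    then obtain \<phi> where \<phi>: "\<phi> \<in> amplitude_range q" "\<phi> < r" "jacobi_am u q < \<phi>"
      using amplitude_range_dense jacobi_am_props[OF q] by blast
    have "((\<lambda>p. elliptic_integral_F \<phi> (snd p) - fst p) \<longlongrightarrow> elliptic_integral_F \<phi> q - u) ?at"
      by (intro tendsto_diff fst elliptic_integral_F_tendsto q \<phi>)
    moreover have "elliptic_integral_F \<phi> q - u > 0"
      using jacobi_am_less_iff[OF q \<phi>(1)] \<phi>(3) by simp
    ultimately have "\<forall>\<^sub>F p in ?at. elliptic_integral_F \<phi> (snd p) - fst p > 0"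
      by (rule order_tendstoD)
    with in_range elliptic_integral_F_tendsto(2)[OF q \<phi>(1), of u]
    show "\<forall>\<^sub>F p in ?at. jacobi_am (fst p) (snd p) < r"
    proof eventually_elim
      case (elim p)
      then show ?case
        using jacobi_am_less_iff(2)[of "snd p" \<phi> "fst p"] \<phi>(2) by simp
    qed
  qed
  then show "((\<lambda>(u, q). jacobi_am u q) \<longlongrightarrow> (case p0 of (u, q) \<Rightarrow> jacobi_am u q)) (at p0 within UNIV \<times> {0..1})"
    unfolding case_prod_beta u_def q_def by simp
qed

lemma jacobi_am_has_derivative:
  assumes q: "0 \<le> q" "q \<le> 1"
  shows "((\<lambda>u. jacobi_am u q) has_real_derivative jacobi_dn u q) (at u)"
proof -
  have "continuous_on UNIV ((\<lambda>(u, q). jacobi_am u q) \<circ> (\<lambda>u. (u, q)))"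
    using q by (intro continuous_on_compose continuous_on_subset[OF continuous_on_jacobi_am]
        continuous_intros) auto
  then have "isCont (\<lambda>u. jacobi_am u q) u"
    by (simp add: o_def continuous_on_eq_continuous_at)
  moreover note elliptic_integral_F_has_derivative[OF q jacobi_am_in_range[OF q], of u]
  moreover have "1 / sqrt (1 - q\<^sup>2 * (sin (jacobi_am u q))\<^sup>2) \<noteq> 0"
    using elliptic_radicand_pos[OF q jacobi_am_in_range[OF q], of u] by simp
  ultimately have "((\<lambda>u. jacobi_am u q) has_real_derivative
      inverse (1 / sqrt (1 - q\<^sup>2 * (sin (jacobi_am u q))\<^sup>2))) (at u)"
    using elliptic_integral_F_jacobi_am[OF q]
    by (intro DERIV_inverse_function[where a = "u - 1" and b = "u + 1"]) auto
  then show ?thesis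
    by (simp add: jacobi_dn_def jacobi_sn_def)
qed

section \<open>The function g and its derivative\<close>

text \<open>
  The derivative of \<open>g\<close>; equal to \<open>(1 + q)/2 \<cdot> dn((1 + q) x/2, k)\<close> for \<open>k = 2 \<surd>q / (1 + q)\<close> by Landen's
  transformation.
\<close>

definition phase_rate :: "real \<Rightarrow> real \<Rightarrow> real" where
  "phase_rate q x =
     (1 + q) / 2 * (1 - q * (jacobi_sn (x / 2) q)\<^sup>2) / (1 + q * (jacobi_sn (x / 2) q)\<^sup>2)"

lemma one_plus_sq_pos: "0 \<le> q \<Longrightarrow> 1 + q * (s::real)\<^sup>2 > 0"
  by (intro add_pos_nonneg) auto

lemma
  assumes q: "0 \<le> q" "q \<le> 1"
  shows jacobi_dn_pos: "jacobi_dn u q > 0"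
    and jacobi_dn_squared: "(jacobi_dn u q)\<^sup>2 = 1 - q\<^sup>2 * (jacobi_sn u q)\<^sup>2"
    and jacobi_cn_squared: "(jacobi_cn u q)\<^sup>2 = 1 - (jacobi_sn u q)\<^sup>2"
  using elliptic_radicand_pos[OF q jacobi_am_in_range[OF q], of u]
  by (simp_all add: jacobi_dn_def jacobi_sn_def jacobi_cn_def cos_squared_eq)

lemma jacobi_sn_has_derivative:
  assumes q: "0 \<le> q" "q \<le> 1"
  shows "((\<lambda>u. jacobi_sn u q) has_real_derivative jacobi_cn u q * jacobi_dn u q) (at u)"
  unfolding jacobi_sn_def jacobi_cn_def
  by (rule DERIV_chain2[OF DERIV_sin jacobi_am_has_derivative[OF q]])

lemma jacobi_cn_has_derivative:
  assumes q: "0 \<le> q" "q \<le> 1"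
  shows "((\<lambda>u. jacobi_cn u q) has_real_derivative - jacobi_sn u q * jacobi_dn u q) (at u)"
  unfolding jacobi_sn_def jacobi_cn_def
  by (rule DERIV_chain2[OF DERIV_cos jacobi_am_has_derivative[OF q]])

lemma jacobi_dn_has_derivative:
  assumes q: "0 \<le> q" "q \<le> 1"
  shows "((\<lambda>u. jacobi_dn u q) has_real_derivative - q\<^sup>2 * jacobi_sn u q * jacobi_cn u q) (at u)"
proof -
  let ?D = "2 * (jacobi_sn u q * (jacobi_cn u q * jacobi_dn u q))"
  have "1 - q\<^sup>2 * (jacobi_sn u q)\<^sup>2 > 0"
    using jacobi_dn_squared[OF q, of u] jacobi_dn_pos[OF q, of u] by (metis zero_less_power)
  moreover have "((\<lambda>u. 1 - q\<^sup>2 * (jacobi_sn u q)\<^sup>2) has_real_derivative - (q\<^sup>2 * ?D)) (at u)"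
    by (auto intro!: derivative_eq_intros jacobi_sn_has_derivative[OF q])
  ultimately have "((\<lambda>u. sqrt (1 - q\<^sup>2 * (jacobi_sn u q)\<^sup>2)) has_real_derivative
      inverse (sqrt (1 - q\<^sup>2 * (jacobi_sn u q)\<^sup>2)) / 2 * (- (q\<^sup>2 * ?D))) (at u)"
    by (intro DERIV_chain2[OF DERIV_real_sqrt])
  moreover have "inverse (jacobi_dn u q) / 2 * (- (q\<^sup>2 * ?D)) = - q\<^sup>2 * jacobi_sn u q * jacobi_cn u q"
    using jacobi_dn_pos[OF q, of u] by (simp add: field_simps)
  ultimately show ?thesis
    by (simp only: jacobi_dn_def)
qed

lemma continuous_on_jacobi_cn:
  "continuous_on (UNIV \<times> {0..1}) (\<lambda>(u, q). jacobi_cn u q)"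
  using continuous_on_jacobi_am
  unfolding jacobi_cn_def case_prod_beta by (intro continuous_intros)

lemma continuous_on_phase_rate:
  "continuous_on (UNIV \<times> {0..1}) (\<lambda>(x, q). phase_rate q x)"
proof -
  have "continuous_on (UNIV \<times> {0..1}) ((\<lambda>(u, q). jacobi_am u q) \<circ> (\<lambda>(x, q). (x / 2, q)))"
    by (intro continuous_on_compose continuous_on_subset[OF continuous_on_jacobi_am])
       (auto simp: case_prod_beta intro!: continuous_intros)
  then have "continuous_on (UNIV \<times> {0..1}) (\<lambda>p. jacobi_sn (fst p / 2) (snd p))"
    unfolding jacobi_sn_def by (intro continuous_intros) (simp add: o_def case_prod_beta)
  moreover have "1 + snd p * (jacobi_sn (fst p / 2) (snd p))\<^sup>2 \<noteq> 0"
    if "p \<in> UNIV \<times> {0..1}" for p :: "real \<times> real"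
    using one_plus_sq_pos[of "snd p"] that by (auto simp: less_le)
  ultimately show ?thesis
    unfolding phase_rate_def case_prod_beta by (intro continuous_intros) auto
qed

lemma continuous_on_phase_rate_fixed:
  assumes "0 \<le> q" "q \<le> 1"
  shows "continuous_on UNIV (phase_rate q)"
proof -
  have "continuous_on UNIV ((\<lambda>(x, q). phase_rate q x) \<circ> (\<lambda>x. (x, q)))"
    using assms by (intro continuous_on_compose continuous_on_subset[OF continuous_on_phase_rate]
        continuous_intros) auto
  then show ?thesis
    by (simp add: o_def)
qed

definition phase :: "real \<Rightarrow> real \<Rightarrow> real" where
  "phase q x = (LBINT t=ereal 0..ereal x. phase_rate q t)"

lemma phase_has_derivative:
  assumes "0 \<le> q" "q \<le> 1"
  shows "(phase q has_real_derivative phase_rate q x) (at x)"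
  unfolding phase_def[abs_def]
  by (rule LBINT_has_real_derivative[of UNIV]) (use continuous_on_phase_rate_fixed[OF assms] in auto)

text \<open>
  The length of the vector whose direction \<open>g\<close> describes; in particular it never vanishes, so that its angle
  is well defined.
\<close>

lemma phase_squares:
  assumes q: "0 \<le> q" "q \<le> 1"
  shows "(jacobi_cn u q * jacobi_dn u q)\<^sup>2 + ((1 + q) * jacobi_sn u q)\<^sup>2 = (1 + q * (jacobi_sn u q)\<^sup>2)\<^sup>2"
  unfolding power_mult_distrib jacobi_cn_squared[OF q] jacobi_dn_squared[OF q]
  by (simp add: power2_eq_square algebra_simps)

text \<open>
  If \<open>(C, S)\<close> rotates with angular velocity \<open>e = h'\<close>, then in the frame that rotates by the angle \<open>h\<close> it is
  at rest, so its component orthogonal to \<open>(cos h, sin h)\<close> stays 0.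
\<close>

lemma rotating_unit_vector:
  fixes h e C S :: "real \<Rightarrow> real"
  assumes h: "\<And>x. (h has_real_derivative e x) (at x)"
    and C: "\<And>x. (C has_real_derivative - e x * S x) (at x)"
    and S: "\<And>x. (S has_real_derivative e x * C x) (at x)"
    and 0: "h 0 = 0" "C 0 = 1" "S 0 = 0"
  shows "sin (h x) * C x = cos (h x) * S x"
proof -
  have "((\<lambda>x. sin (h x) * C x - cos (h x) * S x) has_real_derivative 0) (at y)" for y
    by (auto intro!: derivative_eq_intros h C S simp: algebra_simps)
  then have "sin (h x) * C x - cos (h x) * S x = sin (h 0) * C 0 - cos (h 0) * S 0"
    by (intro DERIV_isconst_all) blast
  then show ?thesis
    using 0 by simp
qed

text \<open>
  Dividing \<open>(c d, (1 + q) s)\<close> by its length \<open>W\<close> gives a unit vector; its derivative is \<open>phase_rate\<close> times the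
  vector turned by a right angle.
\<close>

lemma phase_satisfies_tangent_equation:
  assumes q: "0 \<le> q" "q \<le> 1"
  shows "sin (phase q x) * (jacobi_cn (x / 2) q * jacobi_dn (x / 2) q) =
    cos (phase q x) * ((1 + q) * jacobi_sn (x / 2) q)"
proof -
  define s where "s = (\<lambda>x. jacobi_sn (x / 2) q)"
  define c where "c = (\<lambda>x. jacobi_cn (x / 2) q)"
  define d where "d = (\<lambda>x. jacobi_dn (x / 2) q)"
  define W where "W = (\<lambda>x. 1 + q * (s x)\<^sup>2)"
  have W: "W x > 0" for x
    using one_plus_sq_pos[OF q(1)] by (simp add: W_def)
  \<comment> \<open>The identities \<open>cn\<^sup>2 = 1 - sn\<^sup>2\<close> and \<open>dn\<^sup>2 = 1 - q\<^sup>2 sn\<^sup>2\<close> in the form in which they reduce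
    the derivative of \<open>c d / W\<close> to a polynomial identity in \<open>s\<close>.\<close>
  have c2: "c x * c x = 1 - s x * s x" and d2: "d x * d x = 1 - q * q * (s x * s x)" for x
    using jacobi_cn_squared[OF q, of "x / 2"] jacobi_dn_squared[OF q, of "x / 2"]
    by (simp_all add: s_def c_def d_def power2_eq_square)
  have half: "((\<lambda>x. x / 2) has_real_derivative 1 / 2) (at x)" for x :: real
    by (auto intro!: derivative_eq_intros)
  have s': "(s has_real_derivative c x * d x / 2) (at x)"
    and c': "(c has_real_derivative - s x * d x / 2) (at x)"
    and d': "(d has_real_derivative - q\<^sup>2 * s x * c x / 2) (at x)" for x
    using half[of x, THEN DERIV_chain2[OF jacobi_sn_has_derivative[OF q]]]
      half[of x, THEN DERIV_chain2[OF jacobi_cn_has_derivative[OF q]]]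
      half[of x, THEN DERIV_chain2[OF jacobi_dn_has_derivative[OF q]]]
    by (simp_all add: s_def c_def d_def)
  have W': "(W has_real_derivative q * s x * c x * d x) (at x)" for x
    unfolding W_def by (auto intro!: derivative_eq_intros s')
  have e: "phase_rate q x = (1 + q) / 2 * (1 - q * (s x)\<^sup>2) / W x" for x
    by (simp add: phase_rate_def s_def W_def)
  have "sin (phase q x) * (c x * d x / W x) = cos (phase q x) * ((1 + q) * s x / W x)"
  proof (rule rotating_unit_vector[where h = "phase q" and e = "phase_rate q" and
        C = "\<lambda>x. c x * d x / W x" and S = "\<lambda>x. (1 + q) * s x / W x"])
    fix x
    show "(phase q has_real_derivative phase_rate q x) (at x)"
      by (rule phase_has_derivative[OF q])
    have "((\<lambda>x. (1 + q) * s x / W x) has_real_derivative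
        ((1 + q) * (c x * d x / 2) * W x - (1 + q) * s x * (q * s x * c x * d x)) / (W x * W x)) (at x)"
      using W[of x] by (intro DERIV_divide W' DERIV_cmult s') auto
    moreover have num: "(1 + q) * (c x * d x / 2) * W x - (1 + q) * s x * (q * s x * c x * d x) =
        (1 + q) / 2 * (1 - q * (s x)\<^sup>2) * (c x * d x)"
      by (simp add: W_def power2_eq_square field_simps)
    ultimately show "((\<lambda>x. (1 + q) * s x / W x) has_real_derivative
        phase_rate q x * (c x * d x / W x)) (at x)"
      unfolding num e times_divide_times_eq by simp
    have deriv: "((\<lambda>x. c x * d x / W x) has_real_derivative
        ((- s x * d x / 2 * d x + - q\<^sup>2 * s x * c x / 2 * c x) * W x
          - c x * d x * (q * s x * c x * d x)) / (W x * W x)) (at x)"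
      using W[of x] by (intro DERIV_divide W' DERIV_mult c' d') auto
    have "(- s x * d x / 2 * d x + - q\<^sup>2 * s x * c x / 2 * c x) * W x
          - c x * d x * (q * s x * c x * d x) =
        - s x / 2 * ((d x * d x + q * q * (c x * c x)) * W x + 2 * q * (c x * c x) * (d x * d x))"
      by (simp add: power2_eq_square field_simps)
    also have "\<dots> = - ((1 + q) / 2 * (1 - q * (s x)\<^sup>2) * ((1 + q) * s x))"
      unfolding c2 d2 W_def by (simp add: power2_eq_square field_simps)
    finally have num: "(- s x * d x / 2 * d x + - q\<^sup>2 * s x * c x / 2 * c x) * W x
          - c x * d x * (q * s x * c x * d x) = \<dots>" .
    show "((\<lambda>x. c x * d x / W x) has_real_derivative
        - phase_rate q x * ((1 + q) * s x / W x)) (at x)"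
      using deriv unfolding num e by (simp add: mult.assoc)
  qed (use jacobi_am_0[OF q] in \<open>simp_all add: phase_def W_def c_def d_def s_def jacobi_cn_def
      jacobi_dn_def jacobi_sn_def\<close>)
  then show ?thesis
    using W[of x] by (simp add: c_def d_def s_def field_simps)
qed

text \<open>
  Both lifts give the direction of \<open>(A, B)\<close> up to sign, so they differ by a multiple of \<open>\<pi>\<close> at every point;
  a continuous difference of this kind, vanishing at 0, vanishes everywhere. In contrast to an argument with
  \<open>arctan\<close>, the zeros of \<open>A\<close> need no special treatment.
\<close>

lemma continuous_lift_unique:
  fixes h k A B :: "real \<Rightarrow> real"
  assumes "continuous_on UNIV h" "continuous_on UNIV k" "h 0 = k 0"
    and h: "\<And>x. sin (h x) * A x = cos (h x) * B x"
    and k: "\<And>x. sin (k x) * A x = cos (k x) * B x"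
    and AB: "\<And>x. (A x)\<^sup>2 + (B x)\<^sup>2 \<noteq> 0"
  shows "h = k"
proof -
  have sin0: "sin (h x - k x) = 0" for x
  proof -
    have "sin (h x - k x) * A x = 0" "sin (h x - k x) * B x = 0"
      using h[of x] k[of x] by (simp add: sin_diff, algebra)+
    then show ?thesis
      using AB[of x] by auto
  qed
  have "h x - k x = h 0 - k 0" for x
  proof (rule ccontr)
    assume ne: "h x - k x \<noteq> h 0 - k 0"
    let ?D = "\<lambda>x. h x - k x"
    have conn: "connected (range ?D)"
      using assms by (intro connected_continuous_image continuous_intros) auto
    \<comment> \<open>A value between 0 and \<open>h x - k x\<close> of absolute value less than \<open>\<pi>\<close>, so that its sine
      is not 0.\<close>
    define y where "y = sgn (?D x) * min \<bar>?D x\<bar> (pi / 2)"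
    have "y \<in> range ?D"
    proof (cases "?D x > 0")
      case True
      then show ?thesis
        using connectedD_interval[OF conn, of 0 "?D x" y] assms(3) by (auto simp: y_def)
    next
      case False
      then show ?thesis
        using connectedD_interval[OF conn, of "?D x" 0 y] assms(3) ne by (auto simp: y_def)
    qed
    then have "sin y = 0"
      using sin0 by auto
    moreover have "\<bar>y\<bar> = min \<bar>?D x\<bar> (pi / 2)"
      using ne assms(3) by (simp add: y_def abs_mult abs_sgn_eq)
    then have "0 < \<bar>y\<bar>" "\<bar>y\<bar> \<le> pi / 2"
      using ne assms(3) by (simp, simp only: min.cobounded2)
    then have "0 < \<bar>y\<bar>" "\<bar>y\<bar> < pi"
      using pi_gt_zero by linarith+
    ultimately show False
      using sin_gt_zero[of "\<bar>y\<bar>"] by (auto simp: abs_if split: if_splits)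
  qed
  then show ?thesis
    using assms(3) by auto
qed

lemma g_fun_eq_phase:
  assumes q: "0 \<le> q" "q \<le> 1"
  shows "g_fun q = phase q"
  unfolding g_fun_def
proof (rule the_equality)
  have cont: "continuous_on UNIV (phase q)"
    using phase_has_derivative[OF q] by (intro continuous_at_imp_continuous_on) (auto intro: DERIV_isCont)
  then show "continuous_on UNIV (phase q) \<and> phase q 0 = 0 \<and>
      (\<forall>x. sin (phase q x) * (jacobi_cn (x / 2) q * jacobi_dn (x / 2) q) =
        cos (phase q x) * ((1 + q) * jacobi_sn (x / 2) q))"
    using phase_satisfies_tangent_equation[OF q] by (simp add: phase_def)
  fix h assume h: "continuous_on UNIV h \<and> h 0 = 0 \<and>
      (\<forall>x. sin (h x) * (jacobi_cn (x / 2) q * jacobi_dn (x / 2) q) =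
        cos (h x) * ((1 + q) * jacobi_sn (x / 2) q))"
  show "h = phase q"
  proof (rule continuous_lift_unique)
    show "(jacobi_cn (x / 2) q * jacobi_dn (x / 2) q)\<^sup>2 + ((1 + q) * jacobi_sn (x / 2) q)\<^sup>2 \<noteq> 0" for x
      unfolding phase_squares[OF q] using one_plus_sq_pos[OF q(1), of "jacobi_sn (x / 2) q"] by simp
  qed (use h cont phase_satisfies_tangent_equation[OF q] in \<open>auto simp: phase_def\<close>)
qed

lemma g_fun_has_derivative:
  assumes "0 \<le> q" "q \<le> 1"
  shows "(g_fun q has_real_derivative phase_rate q x) (at x)"
  using phase_has_derivative[OF assms] g_fun_eq_phase[OF assms] by simp

lemma continuous_on_g_fun_param: "continuous_on {0..1} (\<lambda>q. g_fun q x)"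
proof -
  have "continuous_on {0..1} (\<lambda>q. phase q x)"
    unfolding phase_def
    by (intro continuous_on_LBINT_param continuous_on_subset[OF continuous_on_phase_rate]) auto
  then show ?thesis
    by (rule continuous_on_eq) (simp add: g_fun_eq_phase)
qed

lemma F_int_has_derivative:
  assumes "0 \<le> q" "q \<le> 1"
  shows "(F_int q has_real_derivative g_fun q x) (at x)"
proof -
  have "continuous_on UNIV (g_fun q)"
    using g_fun_has_derivative[OF assms] by (intro continuous_at_imp_continuous_on) (auto intro: DERIV_isCont)
  then show ?thesis
    unfolding F_int_def[abs_def] by (intro LBINT_has_real_derivative[of UNIV]) auto
qed

section \<open>Zeros of families of maps between finite-dimensional spaces\<close>

text \<open>
  The lattice \<open>\<int>\<^sup>2\<close> is discrete. Hence all bounded functions on it are continuous, and the Banach space of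
  bounded continuous functions serves as the space in which fixed points are found.
\<close>

instance prod :: (discrete_topology, discrete_topology) discrete_topology
proof
  fix A :: "('a \<times> 'b) set"
  have "open (\<Union>p\<in>A. {fst p} \<times> {snd p})"
    by (intro open_UN ballI open_Times open_discrete)
  also have "(\<Union>p\<in>A. {fst p} \<times> {snd p}) = A"
    by auto
  finally show "open A" .
qed

text \<open>
  The functions that vanish off a finite set \<open>I\<close> form a copy of \<open>\<real>\<^sup>I\<close> inside the normed space of bounded
  functions. The set \<open>I\<close> is a term, not a type, so the types of finite-dimensional vectors do not apply.
\<close>

definition supported :: "'a::discrete_topology set \<Rightarrow> ('a \<Rightarrow> real) \<Rightarrow> 'a \<Rightarrow>\<^sub>C real" where
  "supported I f = Bcontfun (\<lambda>i. if i \<in> I then f i else 0)"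

lemma apply_supported:
  assumes "finite I"
  shows "apply_bcontfun (supported I f) i = (if i \<in> I then f i else 0)"
proof -
  have "(\<lambda>i. if i \<in> I then f i else 0) \<in> bcontfun"
  proof (rule bcontfun_normI)
    show "norm (if i \<in> I then f i else 0) \<le> (\<Sum>i\<in>I. \<bar>f i\<bar>)" for i
      using member_le_sum[OF _ _ assms, of i "\<lambda>i. \<bar>f i\<bar>"] by (auto intro: sum_nonneg)
  qed (rule Topological_Spaces.continuous_on_discrete)
  then show ?thesis
    by (simp add: supported_def Bcontfun_inverse)
qed

lemma bounded_linear_apply_bcontfun:
  "bounded_linear (\<lambda>z :: 'a::topological_space \<Rightarrow>\<^sub>C real. apply_bcontfun z i)"
  by (rule bounded_linear_intro[where K = 1]) (simp_all add: norm_bounded[where 'b = real, simplified])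

lemma supported_eq_sum:
  assumes "finite I"
  shows "supported I f = (\<Sum>k\<in>I. f k *\<^sub>R supported I (\<lambda>i. if i = k then 1 else 0))"
proof (rule bcontfun_eqI)
  fix i
  have "apply_bcontfun (\<Sum>k\<in>I. f k *\<^sub>R supported I (\<lambda>i. if i = k then 1 else 0)) i =
    (\<Sum>k\<in>I. f k * (if i \<in> I then if i = k then 1 else 0 else 0))"
    by (simp add: bounded_linear.linear[OF bounded_linear_apply_bcontfun, THEN linear_sum] apply_supported[OF assms])
  also have "\<dots> = (if i \<in> I then f i else 0)"
    using assms by (cases "i \<in> I") (simp_all add: if_distrib[of "\<lambda>x. _ * x"] cong: if_cong)
  finally show "apply_bcontfun (supported I f) i =
      apply_bcontfun (\<Sum>k\<in>I. f k *\<^sub>R supported I (\<lambda>i. if i = k then 1 else 0)) i"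
    by (simp add: apply_supported[OF assms])
qed

text \<open>
  An injective endomorphism of the finite-dimensional space \<open>\<real>\<^sup>I\<close> maps a basis to an independent set of
  the same size, which therefore spans. The columns of the inverse are preimages of the unit vectors.
\<close>

lemma inverse_matrix_if_trivial_kernel:
  fixes M :: "'a::discrete_topology \<Rightarrow> 'a \<Rightarrow> real"
  assumes fin: "finite I"
    and kernel: "\<And>\<phi>. \<forall>i\<in>I. (\<Sum>k\<in>I. M i k * \<phi> k) = 0 \<Longrightarrow> \<forall>i\<in>I. \<phi> i = 0"
  shows "\<exists>N. \<forall>\<phi>. \<forall>i\<in>I. (\<Sum>k\<in>I. N i k * (\<Sum>j\<in>I. M k j * \<phi> j)) = \<phi> i \<and>
    (\<Sum>k\<in>I. M i k * (\<Sum>j\<in>I. N k j * \<phi> j)) = \<phi> i"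
proof -
  define L where "L = (\<lambda>x. supported I (\<lambda>i. \<Sum>k\<in>I. M i k * apply_bcontfun x k))"
  define e where "e = (\<lambda>k. supported I (\<lambda>i. if i = k then 1 else 0 :: real))"
  define V where "V = span (e ` I)"
  have apply_L: "apply_bcontfun (L x) i = (if i \<in> I then \<Sum>k\<in>I. M i k * apply_bcontfun x k else 0)" for x i
    by (simp add: L_def apply_supported[OF fin])
  have supp: "supported I f = (\<Sum>k\<in>I. f k *\<^sub>R e k)" for f
    unfolding e_def by (rule supported_eq_sum[OF fin])
  have supp_V: "supported I f \<in> V" for f
    unfolding supp V_def by (intro span_sum span_scale span_base) auto
  have V_zero: "apply_bcontfun x i = 0" if "x \<in> V" "i \<notin> I" for x i
    using that(1) unfolding V_def
    by (induction rule: span_induct_alt) (use that(2) in \<open>auto simp: e_def apply_supported[OF fin]\<close>)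
  have "linear L"
    by (rule linearI; rule bcontfun_eqI)
       (simp_all add: apply_L algebra_simps sum.distrib sum_distrib_left)
  have "x = 0" if "x \<in> V" "L x = 0" for x
  proof (rule bcontfun_eqI)
    fix i
    have "(\<Sum>k\<in>I. M j k * apply_bcontfun x k) = 0" if "j \<in> I" for j
      using arg_cong[OF \<open>L x = 0\<close>, of "\<lambda>y. apply_bcontfun y j"] that by (simp add: apply_L)
    then show "apply_bcontfun x i = apply_bcontfun 0 i"
      using kernel[of "apply_bcontfun x"] V_zero[OF \<open>x \<in> V\<close>, of i] by (cases "i \<in> I") auto
  qed
  then have inj: "inj_on L V"
    using \<open>linear L\<close> by (subst linear_inj_on_iff_eq_0) (auto simp: V_def)
  obtain B where B: "B \<subseteq> e ` I" "independent B" "e ` I \<subseteq> span B"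
    by (rule maximal_independent_subset)
  have span_B: "span B = V"
    unfolding V_def using B by (metis span_mono span_span subset_antisym span_minimal subspace_span)
  have "finite B"
    using B(1) fin by (meson finite_imageI finite_subset)
  have indep: "independent (L ` B)"
    using linear_independent_injective_image[OF \<open>linear L\<close> B(2)] inj span_B by simp
  have card: "card (L ` B) = card B"
    using inj span_B by (intro card_image) (metis inj_on_subset span_superset)
  have L_V: "L x \<in> V" for x
    unfolding L_def by (rule supp_V)
  have "B \<subseteq> span (L ` B)"
  proof (rule ccontr)
    assume "\<not> B \<subseteq> span (L ` B)"
    then obtain b where b: "b \<in> B" "b \<notin> span (L ` B)"
      by blast
    then have "independent (insert b (L ` B))"
      using indep by (intro independent_insertI)
    moreover have "insert b (L ` B) \<subseteq> span B"
      using b(1) L_V span_B span_superset by auto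
    ultimately have "card (insert b (L ` B)) \<le> card B"
      using independent_span_bound[OF \<open>finite B\<close>] by blast
    moreover have "b \<notin> L ` B"
      using b(2) span_base[of b "L ` B"] by blast
    ultimately show False
      using card \<open>finite B\<close> by simp
  qed
  then have "V \<subseteq> L ` V"
    using span_B linear_span_image[OF \<open>linear L\<close>, of B] by (metis span_minimal subspace_span)
  moreover have "e k \<in> V" if "k \<in> I" for k
    using that by (simp add: V_def span_base)
  ultimately have "\<exists>n\<in>V. L n = e k" if "k \<in> I" for k
    using that by (metis image_iff subsetD)
  then obtain n where n: "\<And>k. k \<in> I \<Longrightarrow> L (n k) = e k"
    by metis
  define N where "N = (\<lambda>i k. apply_bcontfun (n k) i)"
  have right: "(\<Sum>k\<in>I. M i k * (\<Sum>j\<in>I. N k j * \<phi> j)) = \<phi> i" if "i \<in> I" for \<phi> i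
  proof -
    have "L (\<Sum>j\<in>I. \<phi> j *\<^sub>R n j) = supported I \<phi>"
      unfolding supp by (simp add: linear_sum[OF \<open>linear L\<close>] linear_scale[OF \<open>linear L\<close>] n)
    from arg_cong[OF this, of "\<lambda>y. apply_bcontfun y i"] show ?thesis
      using that
      by (simp add: apply_L apply_supported[OF fin] N_def mult.commute
          bounded_linear.linear[OF bounded_linear_apply_bcontfun, THEN linear_sum])
  qed
  have left: "(\<Sum>k\<in>I. N i k * (\<Sum>j\<in>I. M k j * \<phi> j)) = \<phi> i" if "i \<in> I" for \<phi> i
  proof -
    let ?\<psi> = "\<lambda>i. (\<Sum>k\<in>I. N i k * (\<Sum>j\<in>I. M k j * \<phi> j)) - \<phi> i"
    have "(\<Sum>k\<in>I. M l k * ?\<psi> k) = 0" if "l \<in> I" for l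
      using right[OF that, of "\<lambda>k. \<Sum>j\<in>I. M k j * \<phi> j"] by (simp add: right_diff_distrib sum_subtractf)
    then show ?thesis
      using kernel[of ?\<psi>] that by simp
  qed
  show ?thesis
    by (intro exI[of _ N] allI ballI conjI left right)
qed

text \<open>
  For a family of contractions with a common constant \<open>c\<close>, the distance between the fixed points at the
  parameters \<open>s\<close> and \<open>t\<close> is at most \<open>dist (T t (p s)) (T s (p s)) / (1 - c)\<close>. So continuity in the parameter at
  each fixed argument is enough.
\<close>

lemma contraction_fixpoints_continuous:
  fixes T :: "'b::topological_space \<Rightarrow> 'x::metric_space \<Rightarrow> 'x"
  assumes S: "complete S" "S \<noteq> {}" and c: "0 \<le> c" "c < 1"
    and maps: "\<And>t x. t \<in> E \<Longrightarrow> x \<in> S \<Longrightarrow> T t x \<in> S"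
    and contr: "\<And>t x y. t \<in> E \<Longrightarrow> x \<in> S \<Longrightarrow> y \<in> S \<Longrightarrow> dist (T t x) (T t y) \<le> c * dist x y"
    and cont: "\<And>x. x \<in> S \<Longrightarrow> continuous_on E (\<lambda>t. T t x)"
  shows "\<exists>p. continuous_on E p \<and>
    (\<forall>t\<in>E. p t \<in> S \<and> T t (p t) = p t \<and> (\<forall>x\<in>S. T t x = x \<longrightarrow> x = p t))"
proof -
  have "\<exists>!x\<in>S. T t x = x" if "t \<in> E" for t
    using that maps contr by (intro Banach_fix[OF S c]) auto
  then obtain p where p: "\<And>t. t \<in> E \<Longrightarrow> p t \<in> S \<and> T t (p t) = p t"
    and unique: "\<And>t x. t \<in> E \<Longrightarrow> x \<in> S \<Longrightarrow> T t x = x \<Longrightarrow> x = p t"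
    by metis
  have "continuous_on E p"
    unfolding continuous_on_def
  proof
    fix s assume s: "s \<in> E"
    have lim: "((\<lambda>t. dist (T t (p s)) (T s (p s)) / (1 - c)) \<longlongrightarrow> 0 / (1 - c)) (at s within E)"
      using cont[of "p s"] p[OF s] s c
      by (intro tendsto_intros) (auto simp: continuous_on_def tendsto_dist_iff[symmetric])
    have bound: "\<forall>\<^sub>F t in at s within E. dist (p t) (p s) \<le> dist (T t (p s)) (T s (p s)) / (1 - c)"
    proof (simp add: eventually_at_filter, rule always_eventually, safe)
      fix t assume t: "t \<in> E"
      have "dist (p t) (p s) \<le> dist (T t (p t)) (T t (p s)) + dist (T t (p s)) (T s (p s))"
        using p[OF s] p[OF t] dist_triangle by metis
      also have "\<dots> \<le> c * dist (p t) (p s) + dist (T t (p s)) (T s (p s))"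
        using contr[OF t, of "p t" "p s"] p[OF s] p[OF t] by simp
      finally show "dist (p t) (p s) \<le> dist (T t (p s)) (T s (p s)) / (1 - c)"
        using c by (simp add: field_simps)
    qed
    have "((\<lambda>t. dist (p t) (p s)) \<longlongrightarrow> 0 / (1 - c)) (at s within E)"
    proof (rule tendsto_sandwich[OF _ bound _ lim])
      show "\<forall>\<^sub>F t in at s within E. 0 \<le> dist (p t) (p s)"
        by simp
      show "((\<lambda>_. 0) \<longlongrightarrow> 0 / (1 - c)) (at s within E)"
        by simp
    qed
    then show "(p \<longlongrightarrow> p s) (at s within E)"
      by (subst tendsto_dist_iff) simp
  qed
  then show ?thesis
    using p unique by blast
qed

text \<open>
  A Cauchy sequence of functions supported in the finite set \<open>I\<close> converges at each point of \<open>I\<close>, hence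
  uniformly.
\<close>

lemma complete_supported_box:
  assumes fin: "finite I"
  shows "complete {z :: 'a::discrete_topology \<Rightarrow>\<^sub>C real.
    \<forall>k. \<bar>apply_bcontfun z k\<bar> \<le> (if k \<in> I then \<delta> else 0)}" (is "complete ?S")
proof (rule completeI)
  fix s assume s: "\<forall>n. s n \<in> ?S" and "Cauchy s"
  then have "convergent (\<lambda>n. apply_bcontfun (s n) k)" for k
    by (intro Cauchy_convergent bounded_linear.Cauchy[OF bounded_linear_apply_bcontfun])
  then obtain l where l: "\<And>k. (\<lambda>n. apply_bcontfun (s n) k) \<longlonglongrightarrow> l k"
    unfolding convergent_def by metis
  have bound: "\<bar>l k\<bar> \<le> (if k \<in> I then \<delta> else 0)" for k
    using s by (intro LIMSEQ_le_const2[OF tendsto_rabs[OF l]]) blast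
  have "s n = supported I (apply_bcontfun (s n))" for n
  proof (rule bcontfun_eqI)
    fix k
    have "\<bar>apply_bcontfun (s n) k\<bar> \<le> (if k \<in> I then \<delta> else 0)"
      using s by blast
    then show "apply_bcontfun (s n) k = apply_bcontfun (supported I (apply_bcontfun (s n))) k"
      by (simp add: apply_supported[OF fin] split: if_splits)
  qed
  then have sum: "s = (\<lambda>n. \<Sum>k\<in>I. apply_bcontfun (s n) k *\<^sub>R supported I (\<lambda>i. if i = k then 1 else 0))"
    using supported_eq_sum[OF fin] by metis
  have "(\<lambda>n. \<Sum>k\<in>I. apply_bcontfun (s n) k *\<^sub>R supported I (\<lambda>i. if i = k then 1 else 0))
      \<longlonglongrightarrow> (\<Sum>k\<in>I. l k *\<^sub>R supported I (\<lambda>i. if i = k then 1 else 0))"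
    by (intro tendsto_intros l)
  then have "s \<longlonglongrightarrow> supported I l"
    unfolding supported_eq_sum[OF fin, of l] by (subst sum)
  moreover have "supported I l \<in> ?S"
  proof (rule CollectI, rule allI)
    fix k
    show "\<bar>apply_bcontfun (supported I l) k\<bar> \<le> (if k \<in> I then \<delta> else 0)"
      using bound[of k] by (cases "k \<in> I") (simp_all add: apply_supported[OF fin])
  qed
  ultimately show "\<exists>l\<in>?S. s \<longlonglongrightarrow> l"
    by blast
qed

text \<open>
  Points that agree with \<open>x0\<close> off \<open>I\<close>: the unknowns vary, the boundary values are kept.
\<close>

definition box_around :: "'a set \<Rightarrow> ('a \<Rightarrow> real) \<Rightarrow> real \<Rightarrow> ('a \<Rightarrow> real) set" where
  "box_around I x0 \<delta> = {x. \<forall>k. \<bar>x k - x0 k\<bar> \<le> (if k \<in> I then \<delta> else 0)}"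

lemma box_aroundD: "x \<in> box_around I x0 \<delta> \<Longrightarrow> \<bar>x k - x0 k\<bar> \<le> (if k \<in> I then \<delta> else 0)"
  by (simp add: box_around_def)

text \<open>
  An implicit function theorem with a parameter of low regularity. Let \<open>N\<close> be the inverse of \<open>M\<close>.
  The zeros of \<open>f t\<close> are the fixed points of \<open>x \<mapsto> x - N (f t x)\<close>. As \<open>f t\<close> differs from the linear map
  \<open>M\<close> by a map with small Lipschitz constant, this is a contraction near \<open>x0\<close>, uniformly in \<open>t\<close>. It
  preserves a fixed box as long as \<open>f t x0\<close> is small, that is, for small \<open>t\<close>.
\<close>

lemma zeros_near_nondegenerate_zero:
  fixes f :: "real \<Rightarrow> ('a::discrete_topology \<Rightarrow> real) \<Rightarrow> 'a \<Rightarrow> real"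
  assumes fin: "finite I" and "r > 0"
    and kernel: "\<And>\<phi>. \<forall>i\<in>I. (\<Sum>k\<in>I. M i k * \<phi> k) = 0 \<Longrightarrow> \<forall>i\<in>I. \<phi> i = 0"
    and zero: "\<And>i. i \<in> I \<Longrightarrow> f 0 x0 i = 0"
    and strict: "\<And>\<eta>. \<eta> > 0 \<Longrightarrow> \<exists>\<delta>>0. \<forall>t\<in>{0..<\<delta>}. \<forall>x\<in>box_around I x0 \<delta>. \<forall>y\<in>box_around I x0 \<delta>. \<forall>b.
        (\<forall>k\<in>I. \<bar>x k - y k\<bar> \<le> b) \<longrightarrow>
        (\<forall>i\<in>I. \<bar>f t x i - f t y i - (\<Sum>k\<in>I. M i k * (x k - y k))\<bar> \<le> \<eta> * b)"
    and cont: "\<And>x i. x \<in> box_around I x0 r \<Longrightarrow> i \<in> I \<Longrightarrow> continuous_on {0..<r} (\<lambda>t. f t x i)"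
  shows "\<exists>\<tau> p. 0 < \<tau> \<and> \<tau> \<le> r \<and> p 0 = x0 \<and> (\<forall>k. continuous_on {0..<\<tau>} (\<lambda>t. p t k)) \<and>
    (\<forall>t\<in>{0..<\<tau>}. p t \<in> box_around I x0 r \<and> (\<forall>i\<in>I. f t (p t) i = 0))"
proof -
  obtain N where NM: "\<And>\<phi> i. i \<in> I \<Longrightarrow> (\<Sum>k\<in>I. N i k * (\<Sum>j\<in>I. M k j * \<phi> j)) = \<phi> i"
    and MN: "\<And>\<phi> i. i \<in> I \<Longrightarrow> (\<Sum>k\<in>I. M i k * (\<Sum>j\<in>I. N k j * \<phi> j)) = \<phi> i"
    using inverse_matrix_if_trivial_kernel[of I M, OF fin kernel] by blast
  \<comment> \<open>A bound for the norm of \<open>N\<close>. With the Lipschitz constant \<open>1/(2K)\<close> for the nonlinear part the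
    contraction constant is \<open>1/2\<close>.\<close>
  define K where "K = 1 + (\<Sum>i\<in>I. \<Sum>k\<in>I. \<bar>N i k\<bar>)"
  have K: "K > 0"
    by (simp add: K_def add_pos_nonneg sum_nonneg)
  have row: "\<bar>\<Sum>k\<in>I. N i k * g k\<bar> \<le> K * b" if "i \<in> I" "\<And>k. k \<in> I \<Longrightarrow> \<bar>g k\<bar> \<le> b" "b \<ge> 0" for g b i
  proof -
    have "\<bar>\<Sum>k\<in>I. N i k * g k\<bar> \<le> (\<Sum>k\<in>I. \<bar>N i k\<bar> * b)"
      by (intro sum_abs[THEN order_trans] sum_mono) (auto simp: abs_mult intro: mult_left_mono that)
    also have "\<dots> = (\<Sum>k\<in>I. \<bar>N i k\<bar>) * b"
      by (simp add: sum_distrib_right)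
    also have "(\<Sum>k\<in>I. \<bar>N i k\<bar>) \<le> K"
      using member_le_sum[OF that(1) _ fin, of "\<lambda>i. \<Sum>k\<in>I. \<bar>N i k\<bar>"]
      by (auto simp: K_def intro: sum_nonneg)
    finally show ?thesis
      using that(3) by (simp add: mult_right_mono)
  qed
  have "1 / (2 * K) > 0"
    using K by simp
  from strict[OF this] obtain \<delta>' where \<delta>': "\<delta>' > 0" and
    bound: "\<forall>t\<in>{0..<\<delta>'}. \<forall>x\<in>box_around I x0 \<delta>'. \<forall>y\<in>box_around I x0 \<delta>'. \<forall>b.
      (\<forall>k\<in>I. \<bar>x k - y k\<bar> \<le> b) \<longrightarrow>
      (\<forall>i\<in>I. \<bar>f t x i - f t y i - (\<Sum>k\<in>I. M i k * (x k - y k))\<bar> \<le> 1 / (2 * K) * b)"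
    by blast
  define \<delta> where "\<delta> = min \<delta>' r"
  have \<delta>: "\<delta> > 0" "\<delta> \<le> \<delta>'" "\<delta> \<le> r"
    using \<delta>' \<open>r > 0\<close> by (auto simp: \<delta>_def)
  have box_mono: "box_around I x0 \<delta> \<subseteq> box_around I x0 \<delta>'" "box_around I x0 \<delta> \<subseteq> box_around I x0 r"
    using \<delta> by (force simp: box_around_def split: if_splits)+
  have x0_box: "x0 \<in> box_around I x0 \<delta>"
    using \<delta> by (simp add: box_around_def)
  have "\<forall>\<^sub>F t in at 0 within {0..<r}. \<forall>i\<in>I. \<bar>f t x0 i\<bar> < \<delta> / (2 * K)"
  proof (subst eventually_ball_finite_distrib[OF fin], rule ballI)
    fix i assume "i \<in> I"
    moreover have "x0 \<in> box_around I x0 r"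
      using x0_box box_mono(2) by blast
    ultimately have "((\<lambda>t. f t x0 i) \<longlongrightarrow> f 0 x0 i) (at 0 within {0..<r})"
      using cont[of x0 i] \<open>r > 0\<close> unfolding continuous_on_def by simp
    then have "((\<lambda>t. f t x0 i) \<longlongrightarrow> 0) (at 0 within {0..<r})"
      by (simp add: zero[OF \<open>i \<in> I\<close>])
    then show "\<forall>\<^sub>F t in at 0 within {0..<r}. \<bar>f t x0 i\<bar> < \<delta> / (2 * K)"
      using \<delta>(1) K by (drule_tac e = "\<delta> / (2 * K)" in tendstoD) simp_all
  qed
  then obtain \<tau>' where \<tau>': "\<tau>' > 0"
    "\<And>t i. t \<in> {0..<r} \<Longrightarrow> t \<noteq> 0 \<Longrightarrow> dist t 0 < \<tau>' \<Longrightarrow> i \<in> I \<Longrightarrow> \<bar>f t x0 i\<bar> < \<delta> / (2 * K)"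
    unfolding eventually_at by metis
  define \<tau> where "\<tau> = min \<tau>' \<delta>"
  have \<tau>: "\<tau> > 0" "\<tau> \<le> \<delta>"
    using \<tau>'(1) \<delta>(1) by (auto simp: \<tau>_def)
  have small: "\<bar>f t x0 i\<bar> \<le> \<delta> / (2 * K)" if "t \<in> {0..<\<tau>}" "i \<in> I" for t i
  proof (cases "t = 0")
    case True
    then show ?thesis
      using zero[OF that(2)] \<delta>(1) K by simp
  next
    case False
    then show ?thesis
      using \<tau>'(2)[of t i] that \<tau>(2) \<delta>(3) by (simp add: \<tau>_def)
  qed
  define X where "X = (\<lambda>z k. x0 k + apply_bcontfun z k)"
  define S where "S = {z :: 'a \<Rightarrow>\<^sub>C real. \<forall>k. \<bar>apply_bcontfun z k\<bar> \<le> (if k \<in> I then \<delta> else 0)}"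
  define T where "T = (\<lambda>t z. supported I (\<lambda>i. apply_bcontfun z i - (\<Sum>k\<in>I. N i k * f t (X z) k)))"
  have apply_T: "apply_bcontfun (T t z) i =
      (if i \<in> I then apply_bcontfun z i - (\<Sum>k\<in>I. N i k * f t (X z) k) else 0)" for t z i
    by (simp add: T_def apply_supported[OF fin])
  have X_box: "X z \<in> box_around I x0 \<delta>" if "z \<in> S" for z
    using that by (simp add: X_def S_def box_around_def)
  have "0 \<in> S"
    using \<delta>(1) by (simp add: S_def)
  have "complete S"
    unfolding S_def by (rule complete_supported_box[OF fin])
  have T_diff: "\<bar>apply_bcontfun (T t z) i - apply_bcontfun (T t w) i\<bar> \<le> 1 / 2 * dist z w"
    if "t \<in> {0..<\<tau>}" "z \<in> S" "w \<in> S" for t z w i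
  proof (cases "i \<in> I")
    case True
    let ?R = "\<lambda>k. f t (X z) k - f t (X w) k - (\<Sum>j\<in>I. M k j * (X z j - X w j))"
    have "\<bar>?R k\<bar> \<le> 1 / (2 * K) * dist z w" if "k \<in> I" for k
    proof (rule bound[rule_format])
      show "t \<in> {0..<\<delta>'}"
        using \<open>t \<in> {0..<\<tau>}\<close> \<tau>(2) \<delta>(2) by simp
      show "X z \<in> box_around I x0 \<delta>'" "X w \<in> box_around I x0 \<delta>'"
        using X_box \<open>z \<in> S\<close> \<open>w \<in> S\<close> box_mono(1) by blast+
      show "\<bar>X z k - X w k\<bar> \<le> dist z w" for k
        using dist_bounded[of z k w] by (simp add: X_def dist_real_def)
    qed (rule that)
    then have "\<bar>\<Sum>k\<in>I. N i k * ?R k\<bar> \<le> K * (1 / (2 * K) * dist z w)"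
      using K by (intro row[OF True]) auto
    moreover have "(\<Sum>k\<in>I. N i k * ?R k) = (\<Sum>k\<in>I. N i k * f t (X z) k) - (\<Sum>k\<in>I. N i k * f t (X w) k)
        - (X z i - X w i)"
      using NM[OF True, of "\<lambda>j. X z j - X w j"] by (simp add: right_diff_distrib sum_subtractf)
    moreover have "apply_bcontfun (T t z) i - apply_bcontfun (T t w) i =
        - ((\<Sum>k\<in>I. N i k * f t (X z) k) - (\<Sum>k\<in>I. N i k * f t (X w) k) - (X z i - X w i))"
      using True by (simp add: apply_T X_def)
    ultimately show ?thesis
      using K by (simp only: abs_minus_cancel) simp
  next
    case False
    then show ?thesis
      by (simp add: apply_T)
  qed
  \<comment> \<open>The centre moves by at most half the radius; since \<open>T\<close> halves distances, the box is preserved.\<close>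
  have T_0: "\<bar>apply_bcontfun (T t 0) i\<bar> \<le> (if i \<in> I then \<delta> / 2 else 0)" if "t \<in> {0..<\<tau>}" for t i
  proof -
    have "\<bar>\<Sum>k\<in>I. N i k * f t x0 k\<bar> \<le> K * (\<delta> / (2 * K))" if "i \<in> I"
      using small[OF \<open>t \<in> {0..<\<tau>}\<close>] \<delta>(1) K by (intro row[OF that]) auto
    then show ?thesis
      using K by (simp add: apply_T X_def)
  qed
  have T_S: "T t w \<in> S" if "t \<in> {0..<\<tau>}" "w \<in> S" for t w
    unfolding S_def
  proof safe
    fix k
    have "\<bar>apply_bcontfun w j\<bar> \<le> \<delta>" for j
      using \<open>w \<in> S\<close>[unfolded S_def, simplified, rule_format, of j] \<delta>(1) by (simp split: if_splits)
    then have "norm w \<le> \<delta>"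
      by (intro norm_bound) simp
    then have diff: "\<bar>apply_bcontfun (T t w) k - apply_bcontfun (T t 0) k\<bar> \<le> \<delta> / 2"
      using T_diff[OF that \<open>0 \<in> S\<close>, of k] by simp
    show "\<bar>apply_bcontfun (T t w) k\<bar> \<le> (if k \<in> I then \<delta> else 0)"
    proof (cases "k \<in> I")
      case True
      have "\<bar>apply_bcontfun (T t 0) k\<bar> \<le> \<delta> / 2"
        using T_0[OF that(1), of k] True by simp
      with diff have "\<bar>apply_bcontfun (T t w) k\<bar> \<le> \<delta>"
        by linarith
      then show ?thesis
        using True by simp
    next
      case False
      then show ?thesis
        by (simp add: apply_T)
    qed
  qed
  have T_contr: "dist (T t w) (T t v) \<le> 1 / 2 * dist w v" if "t \<in> {0..<\<tau>}" "w \<in> S" "v \<in> S" for t w v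
    using T_diff[OF that] by (intro dist_bound) (simp add: dist_real_def)
  have T_cont: "continuous_on {0..<\<tau>} (\<lambda>t. T t w)" if "w \<in> S" for w
  proof -
    have "continuous_on {0..<\<tau>} (\<lambda>t. f t (X w) k)" if "k \<in> I" for k
    proof (rule continuous_on_subset)
      show "continuous_on {0..<r} (\<lambda>t. f t (X w) k)"
        using X_box[OF \<open>w \<in> S\<close>] box_mono(2) that by (intro cont) auto
    qed (use \<tau>(2) \<delta>(3) in auto)
    then show ?thesis
      unfolding T_def by (subst supported_eq_sum[OF fin]) (auto intro!: continuous_intros)
  qed
  have "\<exists>z. continuous_on {0..<\<tau>} z \<and> (\<forall>t\<in>{0..<\<tau>}. z t \<in> S \<and> T t (z t) = z t \<and>
      (\<forall>w\<in>S. T t w = w \<longrightarrow> w = z t))"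
    using \<open>complete S\<close> \<open>0 \<in> S\<close> T_S T_contr T_cont
    by (intro contraction_fixpoints_continuous[where c = "1 / 2"]) auto
  then obtain z where z: "continuous_on {0..<\<tau>} z" "\<And>t. t \<in> {0..<\<tau>} \<Longrightarrow> z t \<in> S \<and> T t (z t) = z t"
    and unique: "\<And>t w. t \<in> {0..<\<tau>} \<Longrightarrow> w \<in> S \<Longrightarrow> T t w = w \<Longrightarrow> w = z t"
    by blast
  show ?thesis
  proof (intro exI[of _ \<tau>] exI[of _ "\<lambda>t. X (z t)"] conjI allI ballI)
    show "\<tau> > 0" "\<tau> \<le> r"
      using \<tau> \<delta> by auto
    have "T 0 0 = 0"
      by (rule bcontfun_eqI) (simp add: apply_T X_def zero)
    then show "X (z 0) = x0"
      using unique[of 0 0] \<tau>(1) \<open>0 \<in> S\<close> by (simp add: X_def)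
    show "continuous_on {0..<\<tau>} (\<lambda>t. X (z t) k)" for k
      unfolding X_def
      by (intro continuous_intros bounded_linear.continuous_on[OF bounded_linear_apply_bcontfun] z(1))
    show "X (z t) \<in> box_around I x0 r" if "t \<in> {0..<\<tau>}" for t
      using X_box z(2)[OF that] box_mono(2) by blast
    show "f t (X (z t)) i = 0" if "t \<in> {0..<\<tau>}" "i \<in> I" for t i
    proof -
      have "(\<Sum>j\<in>I. N k j * f t (X (z t)) j) = 0" if "k \<in> I" for k
        using apply_T[of t "z t" k] z(2)[OF \<open>t \<in> {0..<\<tau>}\<close>] that by simp
      then show ?thesis
        using MN[OF that(2), of "f t (X (z t))"] by simp
    qed
  qed
qed

section \<open>Uniformity near the modulus 1\<close>

lemma finite_uniform_bound:
  fixes P :: "'a \<Rightarrow> real \<Rightarrow> bool"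
  assumes "finite A" "\<And>a. a \<in> A \<Longrightarrow> \<exists>\<delta>>0. P a \<delta>"
    and mono: "\<And>a \<delta> \<delta>'. P a \<delta> \<Longrightarrow> 0 < \<delta>' \<Longrightarrow> \<delta>' \<le> \<delta> \<Longrightarrow> P a \<delta>'"
  shows "\<exists>\<delta>>0. \<forall>a\<in>A. P a \<delta>"
  using assms(1,2)
proof (induction A rule: finite_induct)
  case empty
  show ?case
    by (rule exI[of _ 1]) simp
next
  case (insert a A)
  then obtain \<delta> \<delta>' where "\<delta> > 0" "\<forall>a\<in>A. P a \<delta>" "\<delta>' > 0" "P a \<delta>'"
    by (metis insertI1 insertI2)
  then show ?case
    by (intro exI[of _ "min \<delta> \<delta>'"]) (auto intro: mono)
qed

text \<open>
  Continuity at the point \<open>(c, 1)\<close>, in the parameter \<open>t = 1 - q \<ge> 0\<close> of the theorem.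
\<close>

lemma close_near_modulus_1:
  fixes h :: "real \<times> real \<Rightarrow> real"
  assumes "continuous_on (UNIV \<times> {0..1}) h" "e > 0"
  shows "\<exists>\<delta>>0. \<delta> \<le> 1 \<and> (\<forall>t\<in>{0..<\<delta>}. \<forall>x. \<bar>x - c\<bar> \<le> \<delta> \<longrightarrow> \<bar>h (x, 1 - t) - h (c, 1)\<bar> < e)"
proof -
  obtain d where d: "d > 0"
    "\<And>p. p \<in> UNIV \<times> {0..1} \<Longrightarrow> dist p (c, 1) < d \<Longrightarrow> dist (h p) (h (c, 1)) < e"
    using assms unfolding continuous_on_iff by (metis (no_types, lifting) UNIV_I atLeastAtMost_iff mem_Sigma_iff order_refl zero_le_one)
  show ?thesis
  proof (intro exI[of _ "min 1 (d / 3)"] conjI ballI allI impI)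
    fix t x assume t: "t \<in> {0..<min 1 (d / 3)}" and x: "\<bar>x - c\<bar> \<le> min 1 (d / 3)"
    have "dist (x, 1 - t) (c, 1) \<le> \<bar>x - c\<bar> + \<bar>t\<bar>"
      using sqrt_sum_squares_le_sum_abs[of "x - c" t] by (simp add: dist_prod_def dist_real_def)
    also have "\<dots> < d"
      using t x d(1) by auto
    finally show "\<bar>h (x, 1 - t) - h (c, 1)\<bar> < e"
      using d(2)[of "(x, 1 - t)"] t by (auto simp: dist_real_def)
  qed (use d(1) in auto)
qed

text \<open>
  The mean value theorem for \<open>g(x; q) - g'(c; 1) x\<close>, whose derivative is small for \<open>x\<close> near \<open>c\<close> and \<open>q\<close> near 1
  by the joint continuity of \<open>g'\<close>.
\<close>

lemma g_fun_uniformly_strictly_differentiable: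
  assumes "\<eta> > 0"
  shows "\<exists>\<delta>>0. \<forall>t\<in>{0..<\<delta>}. \<forall>u v. \<bar>u - c\<bar> \<le> \<delta> \<longrightarrow> \<bar>v - c\<bar> \<le> \<delta> \<longrightarrow>
    \<bar>g_fun (1 - t) u - g_fun (1 - t) v - phase_rate 1 c * (u - v)\<bar> \<le> \<eta> * \<bar>u - v\<bar>"
proof -
  obtain \<delta> where \<delta>: "\<delta> > 0" "\<delta> \<le> 1"
    "\<And>t x. t \<in> {0..<\<delta>} \<Longrightarrow> \<bar>x - c\<bar> \<le> \<delta> \<Longrightarrow> \<bar>phase_rate (1 - t) x - phase_rate 1 c\<bar> < \<eta>"
    using close_near_modulus_1[OF continuous_on_phase_rate assms, of c] by auto
  have "\<bar>g_fun (1 - t) u - g_fun (1 - t) v - phase_rate 1 c * (u - v)\<bar> \<le> \<eta> * \<bar>u - v\<bar>"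
    if t: "t \<in> {0..<\<delta>}" and uv: "\<bar>u - c\<bar> \<le> \<delta>" "\<bar>v - c\<bar> \<le> \<delta>" for t u v
  proof -
    let ?h = "\<lambda>x. g_fun (1 - t) x - phase_rate 1 c * x"
    have "norm (?h u - ?h v) \<le> \<eta> * norm (u - v)"
    proof (rule field_differentiable_bound[where S = "cball c \<delta>" and f' = "\<lambda>x. phase_rate (1 - t) x - phase_rate 1 c"])
      fix x assume "x \<in> cball c \<delta>"
      then show "norm (phase_rate (1 - t) x - phase_rate 1 c) \<le> \<eta>"
        using \<delta>(3)[OF t, of x] by (simp add: dist_real_def abs_minus_commute)
      show "(?h has_field_derivative phase_rate (1 - t) x - phase_rate 1 c) (at x within cball c \<delta>)"
        using t \<delta>(2) by (auto intro!: derivative_eq_intros has_field_derivative_at_within[OF g_fun_has_derivative])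
    qed (use uv in \<open>auto simp: dist_real_def abs_minus_commute\<close>)
    then show ?thesis
      by (simp add: algebra_simps)
  qed
  then show ?thesis
    using \<delta>(1) by blast
qed

lemma jacobi_cn_1_pos: "jacobi_cn b 1 > 0"
  using jacobi_am_in_range[of 1 b] by (auto simp: jacobi_cn_def amplitude_range_def intro!: cos_gt_zero_pi)

lemma positively_oriented_near_modulus_1:
  "\<exists>\<delta>>0. \<forall>t\<in>{0..<\<delta>}. \<forall>b. \<bar>b - c\<bar> \<le> \<delta> \<longrightarrow> positively_oriented (1 - t) b"
proof -
  obtain \<delta> where "\<delta> > 0"
    "\<And>t x. t \<in> {0..<\<delta>} \<Longrightarrow> \<bar>x - c\<bar> \<le> \<delta> \<Longrightarrow> \<bar>jacobi_cn x (1 - t) - jacobi_cn c 1\<bar> < jacobi_cn c 1"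
    using close_near_modulus_1[OF continuous_on_jacobi_cn jacobi_cn_1_pos[of c], of c] by auto
  then show ?thesis
    unfolding positively_oriented_def by (intro exI[of _ \<delta>]) fastforce
qed

section \<open>The governing equations\<close>

text \<open>
  The left-hand sides of the governing equations when the constants \<open>\<Phi>\<^sub>j\<close> are those of positively oriented
  rings: at the vertex \<open>i\<close> only the edges at \<open>i\<close> contribute. For moduli in \<open>[0, 1]\<close> this is continuous in \<open>\<beta>\<close>
  everywhere, whereas \<open>f_eq\<close> may jump where a boundary ring changes its orientation.
\<close>

definition angle_defect :: "vertex set \<Rightarrow> (vertex \<Rightarrow> real) \<Rightarrow> real \<Rightarrow> (vertex \<Rightarrow> real) \<Rightarrow> vertex \<Rightarrow> real" where
  "angle_defect G \<Theta> q \<beta> i =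
     (\<Sum>(j, k)\<in>edges G. (of_bool (j = i) - of_bool (k = i)) * g_fun q (\<beta> j - \<beta> k)
        - (of_bool (j = i) + of_bool (k = i)) * g_fun q (\<beta> j + \<beta> k))
     + Phi G \<Theta> (\<lambda>_. True) i"

text \<open>
  The Hessian matrix of the functional at \<open>q = 1\<close>.
\<close>

definition defect_matrix :: "vertex set \<Rightarrow> (vertex \<Rightarrow> real) \<Rightarrow> vertex \<Rightarrow> vertex \<Rightarrow> real" where
  "defect_matrix G \<beta> i l =
     (\<Sum>(j, k)\<in>edges G. (of_bool (j = i) - of_bool (k = i)) *
          (phase_rate 1 (\<beta> j - \<beta> k) * (of_bool (j = l) - of_bool (k = l)))
        - (of_bool (j = i) + of_bool (k = i)) *
          (phase_rate 1 (\<beta> j + \<beta> k) * (of_bool (j = l) + of_bool (k = l))))"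

lemma finite_edges: "finite G \<Longrightarrow> finite (edges G)"
  by (rule finite_subset[of _ "G \<times> G"]) (auto simp: edges_def)

text \<open>
  Term by term differentiation, using \<open>F' = g\<close>. Of the constants \<open>\<Phi>\<close> only the one at the vertex \<open>i\<close> survives,
  so only the orientation of the ring \<open>i\<close> matters.
\<close>

lemma f_eq_eq_angle_defect:
  assumes "finite G" "i \<in> G" "0 \<le> q" "q \<le> 1" "positively_oriented q (\<beta> i)"
  shows "f_eq G \<Theta> i \<beta> q = angle_defect G \<Theta> q \<beta> i"
proof -
  let ?\<sigma> = "\<lambda>j. positively_oriented q (\<beta> j)"
  let ?\<beta> = "\<lambda>t. \<beta>(i := t)"
  have coord: "((\<lambda>t. ?\<beta> t j) has_real_derivative of_bool (j = i)) (at (\<beta> i))" for j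
    by (cases "j = i") (auto intro!: derivative_eq_intros)
  have chain: "((\<lambda>t. F_int q (h t)) has_real_derivative g_fun q (h (\<beta> i)) * h') (at (\<beta> i))"
    if "(h has_real_derivative h') (at (\<beta> i))" for h h'
    by (rule DERIV_chain2[OF F_int_has_derivative that]) (use assms in auto)
  have edge: "((\<lambda>t. F_int q (?\<beta> t j - ?\<beta> t k) - F_int q (?\<beta> t j + ?\<beta> t k)) has_real_derivative
      (of_bool (j = i) - of_bool (k = i)) * g_fun q (\<beta> j - \<beta> k)
        - (of_bool (j = i) + of_bool (k = i)) * g_fun q (\<beta> j + \<beta> k)) (at (\<beta> i))" for j k
    using DERIV_diff[OF chain[OF DERIV_diff[OF coord[of j] coord[of k]]]
        chain[OF DERIV_add[OF coord[of j] coord[of k]]]]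
    by (simp only: fun_upd_triv mult.commute)
  have "((\<lambda>t. S_sph G \<Theta> ?\<sigma> (?\<beta> t) q) has_real_derivative
      (\<Sum>(j, k)\<in>edges G. (of_bool (j = i) - of_bool (k = i)) * g_fun q (\<beta> j - \<beta> k)
        - (of_bool (j = i) + of_bool (k = i)) * g_fun q (\<beta> j + \<beta> k)) +
      (\<Sum>j\<in>G. Phi G \<Theta> ?\<sigma> j * of_bool (j = i))) (at (\<beta> i))"
    unfolding S_sph_def case_prod_beta
    by (intro DERIV_add DERIV_sum DERIV_cmult coord edge)
  moreover have "(\<Sum>j\<in>G. Phi G \<Theta> ?\<sigma> j * of_bool (j = i)) = Phi G \<Theta> (\<lambda>_. True) i"
    using assms by (simp add: of_bool_def if_distrib[of "\<lambda>x. _ * x"] Phi_def cong: if_cong)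
  ultimately show ?thesis
    unfolding f_eq_def angle_defect_def by (simp add: DERIV_imp_deriv)
qed

lemma defect_matrix_apply:
  assumes "finite I" "\<And>l. l \<notin> I \<Longrightarrow> \<phi> l = 0"
  shows "(\<Sum>l\<in>I. defect_matrix G \<beta> i l * \<phi> l) =
    (\<Sum>(j, k)\<in>edges G. (of_bool (j = i) - of_bool (k = i)) * (phase_rate 1 (\<beta> j - \<beta> k) * (\<phi> j - \<phi> k))
        - (of_bool (j = i) + of_bool (k = i)) * (phase_rate 1 (\<beta> j + \<beta> k) * (\<phi> j + \<phi> k)))"
proof -
  have pick: "(\<Sum>l\<in>I. of_bool (j = l) * \<phi> l) = \<phi> j" for j
    using assms by (cases "j \<in> I") (auto simp: of_bool_def if_distrib[of "\<lambda>x. x * _"] cong: if_cong)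
  have "(\<Sum>l\<in>I. c * (r * (of_bool (j = l) - of_bool (k = l))) * \<phi> l) =
        c * (r * ((\<Sum>l\<in>I. of_bool (j = l) * \<phi> l) - (\<Sum>l\<in>I. of_bool (k = l) * \<phi> l)))"
      "(\<Sum>l\<in>I. c * (r * (of_bool (j = l) + of_bool (k = l))) * \<phi> l) =
        c * (r * ((\<Sum>l\<in>I. of_bool (j = l) * \<phi> l) + (\<Sum>l\<in>I. of_bool (k = l) * \<phi> l)))" for c r j k
    unfolding sum_subtractf[symmetric] sum.distrib[symmetric] sum_distrib_left
    by (intro sum.cong refl; simp add: algebra_simps)+
  note pick' = this[unfolded pick]
  show ?thesis
    unfolding defect_matrix_def sum_distrib_right
    by (subst sum.swap) (simp add: case_prod_beta left_diff_distrib sum_subtractf pick')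
qed

lemma abs_add_diff_le:
  fixes a b :: real
  assumes "\<bar>a - a'\<bar> \<le> d" "\<bar>b - b'\<bar> \<le> e"
  shows "\<bar>a - b - (a' - b')\<bar> \<le> d + e" "\<bar>a + b - (a' + b')\<bar> \<le> d + e"
  using assms by linarith+

text \<open>
  The hypothesis of \<open>zeros_near_nondegenerate_zero\<close>, inherited from \<open>g\<close>: the constants \<open>\<Phi>\<close> cancel, and the
  remainder is a sum over finitely many edges of remainders of \<open>g\<close> at the points \<open>\<beta>0 j - \<beta>0 k\<close> and \<open>\<beta>0 j + \<beta>0 k\<close>.
\<close>

lemma angle_defect_uniformly_strictly_differentiable:
  assumes fin: "finite G" "finite I" and "\<eta> > 0"
  shows "\<exists>\<delta>>0. \<forall>t\<in>{0..<\<delta>}. \<forall>x\<in>box_around I \<beta>0 \<delta>. \<forall>y\<in>box_around I \<beta>0 \<delta>. \<forall>b.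
        (\<forall>l\<in>I. \<bar>x l - y l\<bar> \<le> b) \<longrightarrow>
        (\<forall>i\<in>I. \<bar>angle_defect G \<Theta> (1 - t) x i - angle_defect G \<Theta> (1 - t) y i
            - (\<Sum>l\<in>I. defect_matrix G \<beta>0 i l * (x l - y l))\<bar> \<le> \<eta> * b)"
proof -
  define m where "m = real (card (edges G))"
  \<comment> \<open>Each edge contributes two terms with a coefficient of absolute value at most 2 and an argument that
    varies by at most \<open>2 b\<close>, so at most \<open>8 \<eta>' b\<close> in total. The summand 1 allows for a graph without edges.\<close>
  define \<eta>' where "\<eta>' = \<eta> / (8 * (m + 1))"
  have "\<eta>' > 0"
    using \<open>\<eta> > 0\<close> by (simp add: \<eta>'_def m_def add_nonneg_pos)
  define C where "C = (\<lambda>(j, k). \<beta>0 j - \<beta>0 k) ` edges G \<union> (\<lambda>(j, k). \<beta>0 j + \<beta>0 k) ` edges G"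
  define close where "close = (\<lambda>c \<delta>. \<forall>t\<in>{0..<\<delta>}. \<forall>u v. \<bar>u - c\<bar> \<le> \<delta> \<longrightarrow> \<bar>v - c\<bar> \<le> \<delta> \<longrightarrow>
    \<bar>g_fun (1 - t) u - g_fun (1 - t) v - phase_rate 1 c * (u - v)\<bar> \<le> \<eta>' * \<bar>u - v\<bar>)"
  have "\<exists>\<delta>>0. \<forall>c\<in>C. close c \<delta>"
  proof (rule finite_uniform_bound)
    show "finite C"
      using finite_edges[OF fin(1)] by (simp add: C_def)
    show "\<exists>\<delta>>0. close c \<delta>" for c
      unfolding close_def by (rule g_fun_uniformly_strictly_differentiable[OF \<open>\<eta>' > 0\<close>])
    show "close c \<delta>'" if "close c \<delta>" "\<delta>' \<le> \<delta>" for c \<delta> \<delta>'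
      unfolding close_def
    proof (intro ballI allI impI)
      fix t u v assume "t \<in> {0..<\<delta>'}" "\<bar>u - c\<bar> \<le> \<delta>'" "\<bar>v - c\<bar> \<le> \<delta>'"
      then show "\<bar>g_fun (1 - t) u - g_fun (1 - t) v - phase_rate 1 c * (u - v)\<bar> \<le> \<eta>' * \<bar>u - v\<bar>"
        using that by (intro that(1)[unfolded close_def, rule_format]) auto
    qed
  qed
  then obtain \<delta> where \<delta>: "\<delta> > 0" and close: "\<And>c. c \<in> C \<Longrightarrow> close c \<delta>"
    by blast
  \<comment> \<open>Halving \<open>\<delta>\<close> keeps sums and differences of two coordinates within \<open>\<delta>\<close>.\<close>
  have "\<bar>angle_defect G \<Theta> (1 - t) x i - angle_defect G \<Theta> (1 - t) y i
            - (\<Sum>l\<in>I. defect_matrix G \<beta>0 i l * (x l - y l))\<bar> \<le> \<eta> * b"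
    if t: "t \<in> {0..<\<delta> / 2}" and x: "x \<in> box_around I \<beta>0 (\<delta> / 2)" and y: "y \<in> box_around I \<beta>0 (\<delta> / 2)"
      and b: "\<forall>l\<in>I. \<bar>x l - y l\<bar> \<le> b" and i: "i \<in> I" for t x y b i
  proof -
    have "b \<ge> 0"
      using b i by force
    have near: "\<bar>x l - \<beta>0 l\<bar> \<le> \<delta> / 2" "\<bar>y l - \<beta>0 l\<bar> \<le> \<delta> / 2" for l
      using box_aroundD[OF x, of l] box_aroundD[OF y, of l] \<delta>
      by (auto split: if_splits)
    have off: "x l - y l = 0" if "l \<notin> I" for l
      using box_aroundD[OF x, of l] box_aroundD[OF y, of l] that by simp
    have diff: "\<bar>x l - y l\<bar> \<le> b" for l
      using b off[of l] \<open>b \<ge> 0\<close> by (cases "l \<in> I") auto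
    let ?r = "\<lambda>c u v. g_fun (1 - t) u - g_fun (1 - t) v - phase_rate 1 c * (u - v)"
    have r: "\<bar>?r c u v\<bar> \<le> \<eta>' * (2 * b)"
      if "c \<in> C" "\<bar>u - c\<bar> \<le> \<delta>" "\<bar>v - c\<bar> \<le> \<delta>" "\<bar>u - v\<bar> \<le> 2 * b" for c u v
    proof -
      have "\<bar>?r c u v\<bar> \<le> \<eta>' * \<bar>u - v\<bar>"
        using t \<delta> that by (intro close[unfolded close_def, rule_format]) auto
      also have "\<dots> \<le> \<eta>' * (2 * b)"
        using that(4) \<open>\<eta>' > 0\<close> by (intro mult_left_mono) auto
      finally show ?thesis .
    qed
    let ?e = "\<lambda>j k. (of_bool (j = i) - of_bool (k = i)) * ?r (\<beta>0 j - \<beta>0 k) (x j - x k) (y j - y k)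
        - (of_bool (j = i) + of_bool (k = i)) * ?r (\<beta>0 j + \<beta>0 k) (x j + x k) (y j + y k)"
    have e: "\<bar>?e j k\<bar> \<le> 8 * \<eta>' * b" if "(j, k) \<in> edges G" for j k
    proof -
      have 1: "\<bar>?r (\<beta>0 j - \<beta>0 k) (x j - x k) (y j - y k)\<bar> \<le> \<eta>' * (2 * b)"
      proof (rule r)
        show "\<beta>0 j - \<beta>0 k \<in> C"
          using that by (force simp: C_def)
      qed (use abs_add_diff_le[OF near(1)[of j] near(1)[of k]] abs_add_diff_le[OF near(2)[of j] near(2)[of k]]
          abs_add_diff_le[OF diff[of j] diff[of k]] in simp_all)
      have 2: "\<bar>?r (\<beta>0 j + \<beta>0 k) (x j + x k) (y j + y k)\<bar> \<le> \<eta>' * (2 * b)"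
      proof (rule r)
        show "\<beta>0 j + \<beta>0 k \<in> C"
          using that by (force simp: C_def)
      qed (use abs_add_diff_le[OF near(1)[of j] near(1)[of k]] abs_add_diff_le[OF near(2)[of j] near(2)[of k]]
          abs_add_diff_le[OF diff[of j] diff[of k]] in simp_all)
      have "\<bar>?e j k\<bar> \<le>
          \<bar>of_bool (j = i) - of_bool (k = i)\<bar> * \<bar>?r (\<beta>0 j - \<beta>0 k) (x j - x k) (y j - y k)\<bar> +
          \<bar>of_bool (j = i) + of_bool (k = i)\<bar> * \<bar>?r (\<beta>0 j + \<beta>0 k) (x j + x k) (y j + y k)\<bar>"
        unfolding abs_mult[symmetric] by (rule abs_triangle_ineq4)
      also have "\<dots> \<le> 2 * (\<eta>' * (2 * b)) + 2 * (\<eta>' * (2 * b))"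
        using 1 2 by (intro add_mono mult_mono) auto
      finally show ?thesis
        by simp
    qed
    have matrix: "(\<Sum>l\<in>I. defect_matrix G \<beta>0 i l * (x l - y l)) =
      (\<Sum>(j, k)\<in>edges G.
        (of_bool (j = i) - of_bool (k = i)) * (phase_rate 1 (\<beta>0 j - \<beta>0 k) * (x j - y j - (x k - y k)))
        - (of_bool (j = i) + of_bool (k = i)) * (phase_rate 1 (\<beta>0 j + \<beta>0 k) * (x j - y j + (x k - y k))))"
      by (rule defect_matrix_apply[OF fin(2) off])
    have split: "angle_defect G \<Theta> (1 - t) x i - angle_defect G \<Theta> (1 - t) y i
            - (\<Sum>l\<in>I. defect_matrix G \<beta>0 i l * (x l - y l)) = (\<Sum>(j, k)\<in>edges G. ?e j k)"
      unfolding matrix angle_defect_def add_diff_cancel_right sum_subtractf[symmetric] case_prod_beta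
      by (intro sum.cong refl) (simp add: algebra_simps)
    have "\<bar>angle_defect G \<Theta> (1 - t) x i - angle_defect G \<Theta> (1 - t) y i
            - (\<Sum>l\<in>I. defect_matrix G \<beta>0 i l * (x l - y l))\<bar> \<le>
        (\<Sum>p\<in>edges G. \<bar>case p of (j, k) \<Rightarrow> ?e j k\<bar>)"
      unfolding split by (rule sum_abs)
    also have "\<dots> \<le> (\<Sum>p\<in>edges G. 8 * \<eta>' * b)"
    proof (rule sum_mono)
      fix p assume "p \<in> edges G"
      then show "\<bar>case p of (j, k) \<Rightarrow> ?e j k\<bar> \<le> 8 * \<eta>' * b"
        by (cases p) (simp only: prod.case e)
    qed
    also have "\<dots> = m * (8 * \<eta>' * b)"
      by (simp add: m_def)
    also have "\<dots> = \<eta> * b * (m / (m + 1))"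
      by (simp add: \<eta>'_def m_def field_simps)
    also have "\<dots> \<le> \<eta> * b * 1"
      using \<open>\<eta> > 0\<close> \<open>b \<ge> 0\<close> by (intro mult_left_mono) (auto simp: m_def divide_simps)
    finally show ?thesis
      by simp
  qed
  then show ?thesis
    using \<delta> by (intro exI[of _ "\<delta> / 2"]) auto
qed

section \<open>Rigidity and the existence of ring patterns\<close>

lemma finite_ring_vertices: "finite Q \<Longrightarrow> finite (ring_vertices Q)"
  by (rule finite_subset[of _ "\<Union>s\<in>Q. square_corners s"]) (auto simp: ring_vertices_def square_corners_def)

lemma continuous_on_angle_defect:
  "continuous_on {0..<1} (\<lambda>t. angle_defect G \<Theta> (1 - t) \<beta> i)"
proof -
  have "continuous_on {0..<1} (\<lambda>t. g_fun (1 - t) x)" for x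
    by (rule continuous_on_compose2[OF continuous_on_g_fun_param]) (auto intro!: continuous_intros)
  then show ?thesis
    unfolding angle_defect_def case_prod_beta by (intro continuous_intros)
qed

lemma f_eq_1: "finite G \<Longrightarrow> i \<in> G \<Longrightarrow> f_eq G \<Theta> i \<beta> 1 = angle_defect G \<Theta> 1 \<beta> i"
  by (rule f_eq_eq_angle_defect) (auto simp: positively_oriented_def jacobi_cn_1_pos)

lemma unknowns_subset: "unknowns G P \<subseteq> G"
  by (cases P) (auto simp: inner_vertices_def)

lemma solves_bvp_1_angle_defect:
  assumes "finite G" "solves_bvp G P \<beta> 1" "i \<in> unknowns G P"
  shows "angle_defect G (cone_angles P) 1 \<beta> i = 0"
proof -
  have "i \<in> G"
    using assms(3) unknowns_subset by blast
  then have "angle_defect G (cone_angles P) 1 \<beta> i = f_eq G (cone_angles P) i \<beta> 1"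
    by (simp add: f_eq_1 assms(1))
  then show ?thesis
    using assms(2,3) by (simp add: solves_bvp_def)
qed

text \<open>
  A kernel vector of the Hessian matrix, extended by 0 to all vertices, is an infinitesimal deformation: along
  it the linear part of the equations vanishes, and the remainder is \<open>o(\<epsilon>)\<close> by strict differentiability
  at \<open>t = 0\<close>.
\<close>

lemma rigid_trivial_kernel:
  assumes fin: "finite G" and sol: "solves_bvp G P \<beta>0 1" and rigid: "rigid G P \<beta>0"
    and kernel: "\<forall>i\<in>unknowns G P. (\<Sum>l\<in>unknowns G P. defect_matrix G \<beta>0 i l * \<phi> l) = 0"
  shows "\<forall>i\<in>unknowns G P. \<phi> i = 0"
proof (rule ccontr)
  assume nonzero: "\<not> (\<forall>i\<in>unknowns G P. \<phi> i = 0)"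
  let ?I = "unknowns G P"
  define \<psi> where "\<psi> = (\<lambda>l. if l \<in> ?I then \<phi> l else 0)"
  define B where "B = 1 + (\<Sum>l\<in>?I. \<bar>\<psi> l\<bar>)"
  have finI: "finite ?I"
    using fin unknowns_subset finite_subset by blast
  have B: "B > 0"
    by (simp add: B_def add_pos_nonneg sum_nonneg)
  have \<psi>_le: "\<bar>\<psi> l\<bar> \<le> B" for l
  proof (cases "l \<in> ?I")
    case True
    then show ?thesis
      using member_le_sum[OF True _ finI, of "\<lambda>l. \<bar>\<psi> l\<bar>"] by (simp add: B_def)
  next
    case False
    then show ?thesis
      using B by (simp add: \<psi>_def)
  qed
  have M\<psi>: "(\<Sum>l\<in>?I. defect_matrix G \<beta>0 i l * \<psi> l) = 0" if "i \<in> ?I" for i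
    using kernel that by (simp add: \<psi>_def)
  have "(\<lambda>e. f_eq G (cone_angles P) i (\<lambda>j. \<beta>0 j + e * \<psi> j) 1) \<in> o[at 0](\<lambda>e. e)" if i: "i \<in> ?I" for i
  proof (rule landau_o.smallI)
    fix c :: real assume "c > 0"
    have "i \<in> G"
      using i unknowns_subset by blast
    have defect_0: "angle_defect G (cone_angles P) 1 \<beta>0 i = 0"
      by (rule solves_bvp_1_angle_defect[OF fin sol i])
    have "c / B > 0"
      using \<open>c > 0\<close> B by simp
    from angle_defect_uniformly_strictly_differentiable[OF fin finI this, of \<beta>0 "cone_angles P"]
    obtain \<delta> where \<delta>: "\<delta> > 0" and strict: "\<forall>t\<in>{0..<\<delta>}. \<forall>x\<in>box_around ?I \<beta>0 \<delta>. \<forall>y\<in>box_around ?I \<beta>0 \<delta>.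
        \<forall>b. (\<forall>l\<in>?I. \<bar>x l - y l\<bar> \<le> b) \<longrightarrow> (\<forall>i\<in>?I.
          \<bar>angle_defect G (cone_angles P) (1 - t) x i - angle_defect G (cone_angles P) (1 - t) y i
            - (\<Sum>l\<in>?I. defect_matrix G \<beta>0 i l * (x l - y l))\<bar> \<le> c / B * b)"
      by blast
    have bound: "\<bar>angle_defect G (cone_angles P) 1 (\<lambda>j. \<beta>0 j + e * \<psi> j) i\<bar> \<le> c * \<bar>e\<bar>"
      if e: "\<bar>e\<bar> < \<delta> / B" for e
    proof -
      have step: "\<bar>e * \<psi> l\<bar> \<le> \<bar>e\<bar> * B" for l
        using \<psi>_le[of l] by (simp add: abs_mult mult_left_mono)
      have "\<bar>e\<bar> * B \<le> \<delta>"
        using e B by (simp add: field_simps)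
      then have le: "\<bar>e * \<psi> l\<bar> \<le> \<delta>" for l
        using step[of l] by linarith
      have box: "(\<lambda>j. \<beta>0 j + e * \<psi> j) \<in> box_around ?I \<beta>0 \<delta>"
        unfolding box_around_def
      proof (rule CollectI, rule allI)
        fix k
        show "\<bar>\<beta>0 k + e * \<psi> k - \<beta>0 k\<bar> \<le> (if k \<in> ?I then \<delta> else 0)"
          using le[of k] by (cases "k \<in> ?I") (simp_all add: \<psi>_def)
      qed
      have base: "\<beta>0 \<in> box_around ?I \<beta>0 \<delta>"
        using \<delta> by (simp add: box_around_def)
      have "0 \<in> {0..<\<delta>}"
        using \<delta> by simp
      from strict[rule_format, OF this box base, of "\<bar>e\<bar> * B", OF _ i]
      have "\<bar>angle_defect G (cone_angles P) (1 - 0) (\<lambda>j. \<beta>0 j + e * \<psi> j) i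
          - angle_defect G (cone_angles P) (1 - 0) \<beta>0 i
          - (\<Sum>l\<in>?I. defect_matrix G \<beta>0 i l * (\<beta>0 l + e * \<psi> l - \<beta>0 l))\<bar> \<le> c / B * (\<bar>e\<bar> * B)"
        using step by simp
      moreover have "(\<Sum>l\<in>?I. defect_matrix G \<beta>0 i l * (\<beta>0 l + e * \<psi> l - \<beta>0 l)) =
          e * (\<Sum>l\<in>?I. defect_matrix G \<beta>0 i l * \<psi> l)"
        by (simp add: sum_distrib_left algebra_simps)
      ultimately show ?thesis
        using defect_0 M\<psi>[OF i] B by simp
    qed
    show "\<forall>\<^sub>F e in at 0. norm (f_eq G (cone_angles P) i (\<lambda>j. \<beta>0 j + e * \<psi> j) 1) \<le> c * norm e"
      unfolding eventually_at
    proof (intro exI[of _ "\<delta> / B"] conjI ballI impI)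
      show "\<delta> / B > 0"
        using \<delta> B by simp
      show "norm (f_eq G (cone_angles P) i (\<lambda>j. \<beta>0 j + e * \<psi> j) 1) \<le> c * norm e"
        if "e \<noteq> 0 \<and> dist e 0 < \<delta> / B" for e
        using bound[of e] that f_eq_1[OF fin \<open>i \<in> G\<close>] by simp
    qed
  qed
  then have "infinitesimal_deformation G P \<beta>0 \<psi>"
    using nonzero by (auto simp: infinitesimal_deformation_def \<psi>_def)
  then show False
    using rigid by (auto simp: rigid_def)
qed

theorem theorem7p2:
  fixes Q G :: "vertex set" and P :: bvp and R \<beta>0 :: "vertex \<Rightarrow> real"
  assumes "simply_connected_complex Q"
    and "G = ring_vertices Q"
    and "\<And>j. j \<in> G \<Longrightarrow> 0 < R j \<and> R j < pi"
    and "\<And>j. j \<in> G \<Longrightarrow> \<beta>0 j = ln (cot (R j / 2))"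
    and "solves_bvp G P \<beta>0 1"
    and "rigid G P \<beta>0"
  shows "\<exists>\<epsilon>0 \<beta>. 0 < \<epsilon>0 \<and> \<epsilon>0 \<le> 1 \<and>
    (\<forall>j\<in>G. \<beta> 0 j = \<beta>0 j \<and> continuous_on {0..<\<epsilon>0} (\<lambda>\<epsilon>::real. \<beta> \<epsilon> j)) \<and>
    (\<forall>\<epsilon>\<in>{0..<\<epsilon>0}. solves_bvp G P (\<beta> \<epsilon>) (1 - \<epsilon>))"
proof -
  let ?I = "unknowns G P"
  have fin: "finite G"
    using assms(1,2) finite_ring_vertices by (simp add: simply_connected_complex_def)
  then have finI: "finite ?I"
    using unknowns_subset finite_subset by blast
  have "\<exists>\<delta>>0. \<forall>j\<in>?I. \<forall>t\<in>{0..<\<delta>}. \<forall>b. \<bar>b - \<beta>0 j\<bar> \<le> \<delta> \<longrightarrow> positively_oriented (1 - t) b"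
    by (rule finite_uniform_bound[OF finI positively_oriented_near_modulus_1]) auto
  then obtain \<delta> where \<delta>: "\<delta> > 0" and
    oriented: "\<And>j t b. j \<in> ?I \<Longrightarrow> t \<in> {0..<\<delta>} \<Longrightarrow> \<bar>b - \<beta>0 j\<bar> \<le> \<delta> \<Longrightarrow> positively_oriented (1 - t) b"
    by blast
  \<comment> \<open>Within the radius \<open>r\<close> all rings that carry an unknown are positively oriented, and \<open>1 - t\<close> is a
    modulus in \<open>[0, 1]\<close>.\<close>
  define r where "r = min 1 \<delta>"
  have r: "r > 0" "r \<le> 1" "r \<le> \<delta>"
    using \<delta> by (auto simp: r_def)
  have "\<exists>\<tau> p. 0 < \<tau> \<and> \<tau> \<le> r \<and> p 0 = \<beta>0 \<and> (\<forall>k. continuous_on {0..<\<tau>} (\<lambda>t. p t k)) \<and>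
      (\<forall>t\<in>{0..<\<tau>}. p t \<in> box_around ?I \<beta>0 r \<and>
        (\<forall>i\<in>?I. angle_defect G (cone_angles P) (1 - t) (p t) i = 0))"
  proof (rule zeros_near_nondegenerate_zero[where M = "defect_matrix G \<beta>0"])
    show "\<forall>i\<in>?I. \<phi> i = 0" if "\<forall>i\<in>?I. (\<Sum>l\<in>?I. defect_matrix G \<beta>0 i l * \<phi> l) = 0" for \<phi>
      by (rule rigid_trivial_kernel[OF fin assms(5,6) that])
    show "angle_defect G (cone_angles P) (1 - 0) \<beta>0 i = 0" if "i \<in> ?I" for i
      using solves_bvp_1_angle_defect[OF fin assms(5) that] by simp
    show "\<exists>\<delta>>0. \<forall>t\<in>{0..<\<delta>}. \<forall>x\<in>box_around ?I \<beta>0 \<delta>. \<forall>y\<in>box_around ?I \<beta>0 \<delta>. \<forall>b.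
        (\<forall>l\<in>?I. \<bar>x l - y l\<bar> \<le> b) \<longrightarrow>
        (\<forall>i\<in>?I. \<bar>angle_defect G (cone_angles P) (1 - t) x i - angle_defect G (cone_angles P) (1 - t) y i
            - (\<Sum>l\<in>?I. defect_matrix G \<beta>0 i l * (x l - y l))\<bar> \<le> \<eta> * b)" if "\<eta> > 0" for \<eta>
      by (rule angle_defect_uniformly_strictly_differentiable[OF fin finI that])
    show "continuous_on {0..<r} (\<lambda>t. angle_defect G (cone_angles P) (1 - t) x i)" for x i
      by (rule continuous_on_subset[OF continuous_on_angle_defect]) (use r in auto)
  qed (use finI r in auto)
  then obtain \<tau> p where \<tau>: "0 < \<tau>" "\<tau> \<le> r" and p: "p 0 = \<beta>0" "\<And>k. continuous_on {0..<\<tau>} (\<lambda>t. p t k)"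
    and box: "\<And>t. t \<in> {0..<\<tau>} \<Longrightarrow> p t \<in> box_around ?I \<beta>0 r"
    and defect: "\<And>t i. t \<in> {0..<\<tau>} \<Longrightarrow> i \<in> ?I \<Longrightarrow> angle_defect G (cone_angles P) (1 - t) (p t) i = 0"
    by blast
  have "solves_bvp G P (p t) (1 - t)" if t: "t \<in> {0..<\<tau>}" for t
    unfolding solves_bvp_def
  proof (intro conjI ballI)
    fix i assume i: "i \<in> ?I"
    have "positively_oriented (1 - t) (p t i)"
      using box_aroundD[OF box[OF t], of i] i t r \<tau> by (intro oriented[OF i]) auto
    then have "f_eq G (cone_angles P) i (p t) (1 - t) = angle_defect G (cone_angles P) (1 - t) (p t) i"
      using i t r \<tau> unknowns_subset[of G P] by (intro f_eq_eq_angle_defect[OF fin]) auto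
    then show "f_eq G (cone_angles P) i (p t) (1 - t) = 0"
      using defect[OF t i] by simp
  next
    have "p t j = \<beta>0 j" if "j \<notin> ?I" for j
      using box_aroundD[OF box[OF t], of j] that by simp
    moreover have "boundary_data G P \<beta>0"
      using assms(5) by (simp add: solves_bvp_def)
    ultimately show "boundary_data G P (p t)"
      by (cases P) (auto simp: boundary_vertices_def)
  qed
  then show ?thesis
    using \<tau> r p by (intro exI[of _ \<tau>] exI[of _ p]) auto
qed

end
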